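(* Let $T$ be a tree of order $n$ and let $D = D(T)$. Then the Seidel energy of $T$ satisfies $$\mathcal{E}(S(T)) \geq 2n - 6 + \sqrt{2(n-D)}.$$
   Context: All graphs are simple and finite. For a graph $G$ with vertex set $\{v_1,\dots,v_n\}$, the Seidel matrix $S(G)$ is the $n\times n$ matrix with zero diagonal, whose $(i,j)$ entry ($i\neq j$) is $-1$ if $v_i$ and $v_j$ are adjacent and $1$ otherwise. For a Hermitian matrix $A$, its energy $\mathcal{E}(A)$ is the sum of the absolute values of its eigenvalues; the Seidel energy of $G$ is $\mathcal{E}(S(G))$. For a tree $T$, $D(T)$ denotes the maximum, over vertices $w$ of $T$, of the number of leaves of $T$ adjacent to $w$. *)

theory Defs
  imports Complex_Main "Jordan_Normal_Form.Char_Poly"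
begin

definition simple_graph :: "nat \<Rightarrow> (nat \<Rightarrow> nat \<Rightarrow> bool) \<Rightarrow> bool" where
  "simple_graph n E \<longleftrightarrow>
     (\<forall>u v. E u v \<longrightarrow> u < n \<and> v < n) \<and>
     (\<forall>u v. E u v \<longrightarrow> E v u) \<and>
     (\<forall>u. \<not> E u u)"

definition connected_graph :: "nat \<Rightarrow> (nat \<Rightarrow> nat \<Rightarrow> bool) \<Rightarrow> bool" where
  "connected_graph n E \<longleftrightarrow> (\<forall>u<n. \<forall>v<n. E\<^sup>*\<^sup>* u v)"

definition is_cycle :: "(nat \<Rightarrow> nat \<Rightarrow> bool) \<Rightarrow> nat list \<Rightarrow> bool" where
  "is_cycle E vs \<longleftrightarrow> length vs \<ge> 3 \<and> distinct vs \<and>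
     (\<forall>i. Suc i < length vs \<longrightarrow> E (vs ! i) (vs ! Suc i)) \<and>
     E (last vs) (hd vs)"

definition is_tree :: "nat \<Rightarrow> (nat \<Rightarrow> nat \<Rightarrow> bool) \<Rightarrow> bool" where
  "is_tree n E \<longleftrightarrow> n \<ge> 1 \<and> simple_graph n E \<and> connected_graph n E \<and>
     (\<nexists>vs. is_cycle E vs)"

definition degree :: "nat \<Rightarrow> (nat \<Rightarrow> nat \<Rightarrow> bool) \<Rightarrow> nat \<Rightarrow> nat" where
  "degree n E v = card {u. u < n \<and> E v u}"

definition is_leaf :: "nat \<Rightarrow> (nat \<Rightarrow> nat \<Rightarrow> bool) \<Rightarrow> nat \<Rightarrow> bool" where
  "is_leaf n E v \<longleftrightarrow> v < n \<and> degree n E v = 1"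

definition max_leaf_nbrs :: "nat \<Rightarrow> (nat \<Rightarrow> nat \<Rightarrow> bool) \<Rightarrow> nat" where
  "max_leaf_nbrs n E = Max ((\<lambda>w. card {u. u < n \<and> E w u \<and> is_leaf n E u}) ` {0..<n})"

definition seidel_matrix :: "nat \<Rightarrow> (nat \<Rightarrow> nat \<Rightarrow> bool) \<Rightarrow> complex mat" where
  "seidel_matrix n E = mat n n (\<lambda>(i, j). if i = j then 0 else if E i j then -1 else 1)"

definition energy :: "complex mat \<Rightarrow> real" where
  "energy A = (\<Sum>x\<in>{x. poly (char_poly A) x = 0}. real (order x (char_poly A)) * cmod x)"

end

theory Submission
  imports Defs "Jordan_Normal_Form.Spectral_Radius" "HOL-Library.Disjoint_Sets"
begin

text \<open>
  The Seidel matrix \<open>S = J - I - 2 A\<close> has trace zero, so half of its energy is the sum of its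
  positive eigenvalues, which dominates the sum of the Rayleigh quotients of \<open>S\<close> over any
  orthogonal family of vectors. Explicit families give two bounds.

  First, the energy of a tree is at least \<open>2 n - 2\<close>: a tree is a star, a double star, or contains
  an induced path on five vertices, and each case has a family of at most three vectors. This
  settles \<open>n - D \<le> 8\<close>.

  Second, partition the vertices into stars with \<open>d\<^sub>1 \<ge> d\<^sub>2 \<ge> \<dots>\<close> leaves. The bottom eigenvectors
  of the stars together with the all-ones vector span a space that yields
  \<open>energy \<ge> 2 n - 8 + 2 (\<Sum>i\<ge>2. 2 sqrt d\<^sub>i - 1)\<close>. If the partition minimises the sum of the
  squared star sizes, then either \<open>d\<^sub>1 \<le> D\<close>, or each leaf of the largest star that is not a leaf
  of the tree has a neighbour in a star of its own with at least \<open>d\<^sub>1 - 1\<close> leaves. In both cases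
  the remaining stars are large enough when \<open>n - D \<ge> 9\<close>.
\<close>

section \<open>Unitary diagonalization of Hermitian matrices\<close>

lemma mat_adjoint_dim [simp]:
  "dim_row (mat_adjoint A) = dim_col A" "dim_col (mat_adjoint A) = dim_row A"
  unfolding mat_adjoint_def by auto

lemma mat_adjoint_carrier [simp, intro]:
  "A \<in> carrier_mat m n \<Longrightarrow> mat_adjoint A \<in> carrier_mat n m"
  unfolding carrier_mat_def by simp

lemma mat_adjoint_index [simp]:
  "i < dim_col A \<Longrightarrow> j < dim_row A \<Longrightarrow> mat_adjoint A $$ (i, j) = conjugate (A $$ (j, i))"
  unfolding mat_adjoint_def mat_of_rows_def by simp

lemma mat_adjoint_mat_adjoint [simp]: "mat_adjoint (mat_adjoint (A :: complex mat)) = A"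
  by (rule eq_matI) auto

lemma mat_adjoint_mult:
  fixes A B :: "complex mat"
  assumes "A \<in> carrier_mat m n" "B \<in> carrier_mat n k"
  shows "mat_adjoint (A * B) = mat_adjoint B * mat_adjoint A"
proof (rule eq_matI)
  fix i j assume "i < dim_row (mat_adjoint B * mat_adjoint A)"
    "j < dim_col (mat_adjoint B * mat_adjoint A)"
  then have "i < k" "j < m" using assms by auto
  then show "mat_adjoint (A * B) $$ (i, j) = (mat_adjoint B * mat_adjoint A) $$ (i, j)"
    using assms by (simp add: scalar_prod_def mult.commute)
qed (use assms in auto)

lemma mat_adjoint_four_block_diag:
  fixes P Q :: "complex mat"
  assumes "P \<in> carrier_mat m m" "Q \<in> carrier_mat n n"
  shows "mat_adjoint (four_block_mat P (0\<^sub>m m n) (0\<^sub>m n m) Q) =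
    four_block_mat (mat_adjoint P) (0\<^sub>m m n) (0\<^sub>m n m) (mat_adjoint Q)"
  by (rule eq_matI) (use assms in auto)

definition vec_normalize :: "complex vec \<Rightarrow> complex vec" where
  "vec_normalize v = of_real (1 / sqrt (Re (v \<bullet>c v))) \<cdot>\<^sub>v v"

lemma cscalar_prod_smult:
  fixes v w :: "complex vec"
  assumes "v \<in> carrier_vec n" "w \<in> carrier_vec n"
  shows "(a \<cdot>\<^sub>v v) \<bullet>c (b \<cdot>\<^sub>v w) = a * cnj b * (v \<bullet>c w)"
  using assms by (simp add: conjugate_smult_vec)

lemma vec_normalize_norm:
  fixes v :: "complex vec"
  assumes "v \<in> carrier_vec n" "v \<noteq> 0\<^sub>v n"
  shows "vec_normalize v \<bullet>c vec_normalize v = 1"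
proof -
  define r where "r = Re (v \<bullet>c v)"
  have "v \<bullet>c v > 0" using assms by simp
  then have norm: "v \<bullet>c v = of_real r" and r_pos: "r > 0"
    by (auto simp: r_def complex_eq_iff less_complex_def)
  have "vec_normalize v \<bullet>c vec_normalize v = of_real (1 / sqrt r * (1 / sqrt r) * r)"
    unfolding vec_normalize_def cscalar_prod_smult[OF assms(1,1)] norm
    by (simp only: complex_cnj_complex_of_real of_real_mult Re_complex_of_real)
  also have "1 / sqrt r * (1 / sqrt r) * r = 1" using r_pos by (simp add: field_simps)
  finally show ?thesis by simp
qed

lemma corthogonal_map_vec_normalize:
  assumes orthogonal: "set us \<subseteq> carrier_vec n" "corthogonal us"
  shows "corthogonal (map vec_normalize us)"
    and "w \<in> set (map vec_normalize us) \<Longrightarrow> w \<bullet>c w = 1"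
proof -
  have norm: "vec_normalize (us ! i) \<bullet>c vec_normalize (us ! i) = 1" if "i < length us" for i
  proof (rule vec_normalize_norm)
    show "us ! i \<in> carrier_vec n" using orthogonal(1) that by auto
    then show "us ! i \<noteq> 0\<^sub>v n" using corthogonalD[OF orthogonal(2) that that] by auto
  qed
  then show "w \<in> set (map vec_normalize us) \<Longrightarrow> w \<bullet>c w = 1"
    by (auto simp: in_set_conv_nth)
  show "corthogonal (map vec_normalize us)"
  proof (rule corthogonalI)
    fix i j assume "i < length (map vec_normalize us)" "j < length (map vec_normalize us)"
    then have indices: "i < length us" "j < length us" by auto
    then have carrier: "us ! i \<in> carrier_vec n" "us ! j \<in> carrier_vec n" using orthogonal(1) by auto
    show "(map vec_normalize us ! i \<bullet>c map vec_normalize us ! j = 0) = (i \<noteq> j)"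
    proof (cases "i = j")
      case True
      then show ?thesis using norm[OF indices(1)] indices by simp
    next
      case False
      then have "us ! i \<bullet>c us ! j = 0" using corthogonalD[OF orthogonal(2) indices] by simp
      then show ?thesis
        using indices False by (simp add: vec_normalize_def cscalar_prod_smult[OF carrier])
    qed
  qed
qed

lemma orthonormal_completion:
  fixes v :: "complex vec"
  assumes unit: "v \<in> carrier_vec n" "v \<bullet>c v = 1"
  obtains ws where "hd ws = v" "length ws = n" "set ws \<subseteq> carrier_vec n" "corthogonal ws"
    "\<And>w. w \<in> set ws \<Longrightarrow> w \<bullet>c w = 1"
proof -
  interpret cof_vec_space n "TYPE(complex)" .
  have nonzero: "v \<noteq> 0\<^sub>v n" using unit by auto
  note completion = basis_completion[OF unit(1) nonzero]
  obtain bs where completion_eq: "basis_completion v = v # bs"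
    using completion(6,7) unit nonzero by (cases "basis_completion v") auto
  define us where "us = gram_schmidt n (basis_completion v)"
  note orthogonalized = gram_schmidt_result[OF completion(2,4,5) us_def]
  show thesis
  proof (rule that)
    show "length (map vec_normalize us) = n" using orthogonalized(4) completion(6) by simp
    have "hd us = v" unfolding us_def completion_eq by (rule gram_schmidt_hd[OF unit(1)])
    moreover have "us \<noteq> []" using orthogonalized(4) completion_eq by auto
    ultimately show "hd (map vec_normalize us) = v"
      using unit by (simp add: hd_map vec_normalize_def)
    show "set (map vec_normalize us) \<subseteq> carrier_vec n"
      using orthogonalized(3) by (auto simp: vec_normalize_def)
  qed (use corthogonal_map_vec_normalize[OF orthogonalized(3,2)] in auto)
qed

lemma unitary_with_first_eigenvector:
  fixes A :: "complex mat"
  assumes A_carrier: "A \<in> carrier_mat n n" and n_pos: "n > 0"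
  obtains W e where "W \<in> carrier_mat n n" "mat_adjoint W * W = 1\<^sub>m n" "W * mat_adjoint W = 1\<^sub>m n"
    "col (mat_adjoint W * A * W) 0 = vec n (\<lambda>i. if i = 0 then e else 0)"
proof -
  obtain e where "eigenvalue A e"
    using spectrum_non_empty[OF A_carrier n_pos] unfolding spectrum_def by auto
  then obtain u where eigenvector_u: "u \<in> carrier_vec n" "u \<noteq> 0\<^sub>v n" "A *\<^sub>v u = e \<cdot>\<^sub>v u"
    unfolding eigenvalue_def eigenvector_def using A_carrier by auto
  define v where "v = vec_normalize u"
  have eigenvector_v: "v \<in> carrier_vec n" "v \<bullet>c v = 1" "A *\<^sub>v v = e \<cdot>\<^sub>v v"
    using eigenvector_u A_carrier vec_normalize_norm[OF eigenvector_u(1,2)]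
    by (auto simp: v_def vec_normalize_def mult_mat_vec smult_smult_assoc mult.commute)
  then have v_nonzero: "v \<noteq> 0\<^sub>v n" by auto
  obtain ws where basis: "hd ws = v" "length ws = n" "set ws \<subseteq> carrier_vec n" "corthogonal ws"
    and norm: "\<And>w. w \<in> set ws \<Longrightarrow> w \<bullet>c w = 1"
    using orthonormal_completion[OF eigenvector_v(1,2)] by blast
  define W where "W = mat_of_cols n ws"
  have W_carrier: "W \<in> carrier_mat n n"
    using basis(2) mat_of_cols_carrier(1)[of n ws] by (simp add: W_def)
  have cols: "cols W = ws" using basis by (simp add: W_def cols_mat_of_cols)
  have "map vec_inv ws = map conjugate ws"
    using norm by (auto simp: vec_inv_def)
  then have inv_eq_adjoint: "corthogonal_inv W = mat_adjoint W"
    by (simp only: corthogonal_inv_def mat_adjoint_def cols)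
  then have "inverts_mat (mat_adjoint W) W"
    using corthogonal_inv[OF basis(4,3)] basis(2) W_carrier
    by (simp add: corthogonal_inv_def cols W_def[symmetric])
  then have unitary: "mat_adjoint W * W = 1\<^sub>m n" using W_carrier by (simp add: inverts_mat_def)
  show thesis
  proof (rule that[OF W_carrier unitary])
    show "W * mat_adjoint W = 1\<^sub>m n"
      by (rule mat_mult_left_right_inverse[OF _ W_carrier unitary]) (use W_carrier in simp)
    show "col (mat_adjoint W * A * W) 0 = vec n (\<lambda>i. if i = 0 then e else 0)"
      using corthogonal_col_ev_0[OF A_carrier eigenvector_v(1) v_nonzero eigenvector_v(3) _
          basis(1,3,4,2)] n_pos
      unfolding W_def[symmetric] inv_eq_adjoint by simp
  qed
qed

lemma hermitian_first_column_block:
  fixes A :: "complex mat"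
  assumes hermitian_A: "A \<in> carrier_mat (Suc n) (Suc n)" "mat_adjoint A = A"
    and first_col: "col A 0 = vec (Suc n) (\<lambda>i. if i = 0 then e else 0)"
  obtains B where "B \<in> carrier_mat n n" "mat_adjoint B = B"
    "A = four_block_mat (mat 1 1 (\<lambda>_. of_real (Re e))) (0\<^sub>m 1 n) (0\<^sub>m n 1) B"
proof -
  define B where "B = mat n n (\<lambda>(i, j). A $$ (Suc i, Suc j))"
  have entry_cnj: "A $$ (i, j) = cnj (A $$ (j, i))" if "i < Suc n" "j < Suc n" for i j
    using hermitian_A that mat_adjoint_index[of i A j] by auto
  have entry_first_col: "A $$ (i, 0) = (if i = 0 then e else 0)" if "i < Suc n" for i
    using arg_cong[OF first_col, of "\<lambda>v. v $ i"] hermitian_A(1) that by simp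
  have e_real: "of_real (Re e) = e"
    using entry_cnj[of 0 0] entry_first_col[of 0] by (simp add: complex_eq_iff)
  show thesis
  proof (rule that)
    show "B \<in> carrier_mat n n" by (simp add: B_def)
    show "mat_adjoint B = B"
      by (rule eq_matI) (auto simp: B_def entry_cnj[symmetric])
    show "A = four_block_mat (mat 1 1 (\<lambda>_. of_real (Re e))) (0\<^sub>m 1 n) (0\<^sub>m n 1) B" (is "A = ?F")
    proof (rule eq_matI)
      fix i j assume "i < dim_row ?F" "j < dim_col ?F"
      then show "A $$ (i, j) = ?F $$ (i, j)"
        using entry_first_col[of i] entry_cnj[of 0 j] entry_first_col[of j] e_real
        by (cases i; cases j) (auto simp: B_def)
    qed (use hermitian_A in \<open>auto simp: B_def\<close>)
  qed
qed

lemma hermitian_unitarily_similar_block: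
  fixes A :: "complex mat"
  assumes hermitian_A: "A \<in> carrier_mat (Suc n) (Suc n)" "mat_adjoint A = A"
  obtains W a B where "W \<in> carrier_mat (Suc n) (Suc n)" "B \<in> carrier_mat n n" "mat_adjoint B = B"
    "similar_mat_wit A (four_block_mat (mat 1 1 (\<lambda>_. of_real a)) (0\<^sub>m 1 n) (0\<^sub>m n 1) B)
      W (mat_adjoint W)"
proof -
  obtain W e where W_carrier: "W \<in> carrier_mat (Suc n) (Suc n)"
    and unitary: "mat_adjoint W * W = 1\<^sub>m (Suc n)" "W * mat_adjoint W = 1\<^sub>m (Suc n)"
    and first_col: "col (mat_adjoint W * A * W) 0 = vec (Suc n) (\<lambda>i. if i = 0 then e else 0)"
    using unitary_with_first_eigenvector[OF hermitian_A(1)] by blast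
  define A' where "A' = mat_adjoint W * A * W"
  have A'_carrier: "A' \<in> carrier_mat (Suc n) (Suc n)"
    unfolding A'_def using W_carrier hermitian_A(1) by (intro mult_carrier_mat) auto
  have "similar_mat_wit A' A (mat_adjoint W) W"
    by (rule similar_mat_witI[OF unitary A'_def]) (use W_carrier hermitian_A A'_carrier in auto)
  then have similar_A: "similar_mat_wit A A' W (mat_adjoint W)" by (rule similar_mat_wit_sym)
  have "mat_adjoint A' = A'"
    using W_carrier hermitian_A
    by (simp add: A'_def mat_adjoint_mult[of _ "Suc n" "Suc n" _ "Suc n"]
        mult_carrier_mat[of _ "Suc n" "Suc n"]
          assoc_mult_mat[of _ "Suc n" "Suc n" _ "Suc n" _ "Suc n"])
  with A'_carrier obtain B where "B \<in> carrier_mat n n" "mat_adjoint B = B"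
    and "A' = four_block_mat (mat 1 1 (\<lambda>_. of_real (Re e))) (0\<^sub>m 1 n) (0\<^sub>m n 1) B"
    using hermitian_first_column_block[of A' n e] first_col unfolding A'_def by blast
  with W_carrier similar_A show thesis using that by blast
qed

definition real_diag_mat :: "nat \<Rightarrow> (nat \<Rightarrow> real) \<Rightarrow> complex mat" where
  "real_diag_mat n d = mat n n (\<lambda>(i, j). if i = j then of_real (d i) else 0)"

lemma real_diag_mat_carrier [simp]: "real_diag_mat n d \<in> carrier_mat n n"
  by (simp add: real_diag_mat_def)

lemma real_diag_mat_Suc:
  "real_diag_mat (Suc n) (case_nat a d) =
    four_block_mat (mat 1 1 (\<lambda>_. of_real a)) (0\<^sub>m 1 n) (0\<^sub>m n 1) (real_diag_mat n d)"
  by (rule eq_matI) (auto simp: real_diag_mat_def split: nat.splits)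

lemma hermitian_unitarily_similar_diag:
  fixes A :: "complex mat"
  assumes "A \<in> carrier_mat n n" "mat_adjoint A = A"
  shows "\<exists>P d. similar_mat_wit A (real_diag_mat n d) P (mat_adjoint P)"
  using assms
proof (induction n arbitrary: A)
  case 0
  then have "similar_mat_wit A (real_diag_mat 0 d) A (mat_adjoint A)" for d
    by (intro similar_mat_witI[of _ _ 0] eq_matI) (auto simp: real_diag_mat_def)
  then show ?case by blast
next
  case (Suc n)
  obtain W a B where W_carrier: "W \<in> carrier_mat (Suc n) (Suc n)"
    and hermitian_B: "B \<in> carrier_mat n n" "mat_adjoint B = B"
    and similar_A: "similar_mat_wit A
      (four_block_mat (mat 1 1 (\<lambda>_. of_real a)) (0\<^sub>m 1 n) (0\<^sub>m n 1) B) W (mat_adjoint W)"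
    by (rule hermitian_unitarily_similar_block[OF Suc.prems])
  obtain P d where similar_B: "similar_mat_wit B (real_diag_mat n d) P (mat_adjoint P)"
    using Suc.IH[OF hermitian_B] by blast
  have P_carrier: "P \<in> carrier_mat n n" using similar_mat_witD2[OF hermitian_B(1) similar_B] by simp
  define Q where "Q = four_block_mat (1\<^sub>m 1) (0\<^sub>m 1 n) (0\<^sub>m n 1) P"
  have Q_carrier: "Q \<in> carrier_mat (Suc n) (Suc n)" using P_carrier by (auto simp: Q_def)
  have "mat_adjoint (1\<^sub>m 1 :: complex mat) = 1\<^sub>m 1" by (rule eq_matI) auto
  then have adj_Q: "mat_adjoint Q = four_block_mat (1\<^sub>m 1) (0\<^sub>m 1 n) (0\<^sub>m n 1) (mat_adjoint P)"
    unfolding Q_def by (subst mat_adjoint_four_block_diag) (use P_carrier in auto)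
  have "similar_mat_wit (four_block_mat (mat 1 1 (\<lambda>_. of_real a)) (0\<^sub>m 1 n) (0\<^sub>m n 1) B)
      (real_diag_mat (Suc n) (case_nat a d)) Q (mat_adjoint Q)"
    unfolding real_diag_mat_Suc adj_Q unfolding Q_def
    by (rule similar_mat_wit_four_block[OF similar_mat_wit_refl similar_B])
      (use P_carrier hermitian_B in auto)
  then have "similar_mat_wit A (real_diag_mat (Suc n) (case_nat a d)) (W * Q) (mat_adjoint (W * Q))"
    unfolding mat_adjoint_mult[OF W_carrier Q_carrier] by (rule similar_mat_wit_trans[OF similar_A])
  then show ?case by blast
qed

section \<open>The energy of a real symmetric matrix\<close>

lemma sum_count_list_mult:
  fixes f :: "'a \<Rightarrow> real"
  assumes "finite X" "set xs \<subseteq> X"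
  shows "(\<Sum>x\<in>X. real (count_list xs x) * f x) = (\<Sum>x\<leftarrow>xs. f x)"
  using assms(2)
proof (induction xs)
  case (Cons y ys)
  have "(\<Sum>x\<in>X. real (count_list (y # ys) x) * f x) =
      (\<Sum>x\<in>X. (if x = y then f y else 0) + real (count_list ys x) * f x)"
    by (intro sum.cong refl) (auto simp: algebra_simps)
  then show ?case using Cons assms(1) by (simp add: sum.distrib)
qed simp

lemma energy_prod_list:
  assumes "char_poly A = (\<Prod>a\<leftarrow>as. [:- a, 1:])"
  shows "energy A = (\<Sum>a\<leftarrow>as. cmod a)"
proof -
  have roots: "{x. poly (\<Prod>a\<leftarrow>as. [:- a, 1:]) x = 0} = set as"
    by (auto simp: poly_prod_list o_def prod_list_zero_iff)
  have "order x (\<Prod>a\<leftarrow>as. [:- a, 1:]) = (\<Sum>a\<leftarrow>as. order x [:- a, 1:])" for x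
    by (subst order_prod_list) (auto simp: o_def)
  also have "(\<Sum>a\<leftarrow>as. order x [:- a, 1:]) = count_list as x" for x
    by (induction as) (auto simp: order_linear')
  finally show ?thesis
    unfolding energy_def assms roots
    using sum_count_list_mult[of "set as" as cmod] by simp
qed

lemma energy_unitarily_similar_diag:
  assumes "similar_mat_wit A (real_diag_mat n d) P Q"
  shows "energy A = (\<Sum>j<n. \<bar>d j\<bar>)"
proof -
  have "char_poly A = char_poly (real_diag_mat n d)"
    using assms by (intro char_poly_similar) (auto simp: similar_mat_def)
  also have "\<dots> = (\<Prod>a\<leftarrow>diag_mat (real_diag_mat n d). [:- a, 1:])"
    by (rule char_poly_upper_triangular[of _ n]) (auto simp: real_diag_mat_def)
  finally have "energy A = (\<Sum>a\<leftarrow>diag_mat (real_diag_mat n d). cmod a)"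
    by (rule energy_prod_list)
  also have "diag_mat (real_diag_mat n d) = map (\<lambda>j. complex_of_real (d j)) [0..<n]"
    by (auto simp: diag_mat_def real_diag_mat_def)
  finally show ?thesis
    by (simp add: o_def interv_sum_list_conv_sum_set_nat atLeast0LessThan)
qed

lemma unitary_diag_entry:
  assumes P_carrier: "P \<in> carrier_mat n n" and less: "u < n" "v < n"
  shows "(P * real_diag_mat n d * mat_adjoint P) $$ (u, v) =
    (\<Sum>j<n. of_real (d j) * (P $$ (u, j) * cnj (P $$ (v, j))))"
proof -
  have entry: "(P * real_diag_mat n d) $$ (u, j) = P $$ (u, j) * of_real (d j)" if "j < n" for j
  proof -
    have "(P * real_diag_mat n d) $$ (u, j) =
        (\<Sum>k<n. P $$ (u, k) * (if k = j then of_real (d k) else 0))"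
      using that P_carrier less by (auto simp: scalar_prod_def atLeast0LessThan real_diag_mat_def)
    then show ?thesis using that by (simp add: if_distrib cong: if_cong)
  qed
  have "(P * real_diag_mat n d * mat_adjoint P) $$ (u, v) =
      (\<Sum>j<n. (P * real_diag_mat n d) $$ (u, j) * mat_adjoint P $$ (j, v))"
    using less P_carrier by (subst index_mult_mat)
      (auto simp: scalar_prod_def atLeast0LessThan real_diag_mat_def)
  also have "\<dots> = (\<Sum>j<n. of_real (d j) * (P $$ (u, j) * cnj (P $$ (v, j))))"
    using P_carrier less by (intro sum.cong refl) (simp add: entry)
  finally show ?thesis .
qed

lemma unitary_col_norm:
  assumes "P \<in> carrier_mat n n" "mat_adjoint P * P = 1\<^sub>m n" "j < n"
  shows "(\<Sum>v<n. (cmod (P $$ (v, j)))\<^sup>2) = 1"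
proof -
  have "complex_of_real (\<Sum>v<n. (cmod (P $$ (v, j)))\<^sup>2) = (\<Sum>v<n. P $$ (v, j) * cnj (P $$ (v, j)))"
    unfolding of_real_sum complex_norm_square ..
  also have "\<dots> = (mat_adjoint P * P) $$ (j, j)"
    using assms(1,3) by (simp add: scalar_prod_def atLeast0LessThan mult.commute)
  also have "\<dots> = complex_of_real 1" using assms(2,3) by simp
  finally show ?thesis using of_real_eq_iff by blast
qed

definition quad_form :: "nat \<Rightarrow> (nat \<Rightarrow> nat \<Rightarrow> real) \<Rightarrow> (nat \<Rightarrow> real) \<Rightarrow> real" where
  "quad_form n s x = (\<Sum>u<n. \<Sum>v<n. x u * x v * s u v)"

lemma quad_form_eigenvectors:
  assumes spectral: "\<And>u v. u < n \<Longrightarrow> v < n \<Longrightarrow>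
    complex_of_real (s u v) = (\<Sum>j<n. of_real (d j) * (p u j * cnj (p v j)))"
  shows "quad_form n s x = (\<Sum>j<n. d j * (cmod (\<Sum>v<n. of_real (x v) * p v j))\<^sup>2)"
proof -
  define t where "t j u v =
    of_real (d j) * ((of_real (x u) * p u j) * (of_real (x v) * cnj (p v j)))" for j u v
  have "complex_of_real (quad_form n s x) = (\<Sum>u<n. \<Sum>v<n. \<Sum>j<n. t j u v)"
    unfolding quad_form_def of_real_sum
    by (intro sum.cong refl) (simp add: spectral t_def sum_distrib_left mult_ac)
  also have "\<dots> = (\<Sum>u<n. \<Sum>j<n. \<Sum>v<n. t j u v)"
    by (intro sum.cong refl sum.swap)
  also have "\<dots> = (\<Sum>j<n. \<Sum>u<n. \<Sum>v<n. t j u v)"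
    by (rule sum.swap)
  also have "\<dots> = (\<Sum>j<n. of_real (d j) *
      ((\<Sum>u<n. of_real (x u) * p u j) * cnj (\<Sum>v<n. of_real (x v) * p v j)))"
    unfolding t_def cnj_sum sum_product by (simp add: sum_distrib_left)
  also have "\<dots> = complex_of_real (\<Sum>j<n. d j * (cmod (\<Sum>v<n. of_real (x v) * p v j))\<^sup>2)"
    unfolding complex_norm_square[symmetric] by simp
  finally show ?thesis using of_real_eq_iff by blast
qed

lemma real_symmetric_spectral_decomposition:
  fixes s :: "nat \<Rightarrow> nat \<Rightarrow> real"
  assumes sym: "\<And>u v. u < n \<Longrightarrow> v < n \<Longrightarrow> s u v = s v u"
  obtains d :: "nat \<Rightarrow> real" and p :: "nat \<Rightarrow> nat \<Rightarrow> complex"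
  where "energy (mat n n (\<lambda>(u, v). complex_of_real (s u v))) = (\<Sum>j<n. \<bar>d j\<bar>)"
    and "(\<Sum>v<n. s v v) = (\<Sum>j<n. d j)"
    and "\<And>j. j < n \<Longrightarrow> (\<Sum>v<n. (cmod (p v j))\<^sup>2) = 1"
    and "\<And>x. quad_form n s x = (\<Sum>j<n. d j * (cmod (\<Sum>v<n. of_real (x v) * p v j))\<^sup>2)"
proof -
  define A where "A = mat n n (\<lambda>(u, v). complex_of_real (s u v))"
  have A_carrier: "A \<in> carrier_mat n n" by (simp add: A_def)
  have "mat_adjoint A = A"
    by (rule eq_matI) (use sym in \<open>auto simp: A_def\<close>)
  from hermitian_unitarily_similar_diag[OF A_carrier this] obtain P d
    where similar_A: "similar_mat_wit A (real_diag_mat n d) P (mat_adjoint P)" by blast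
  note similarD = similar_mat_witD2[OF A_carrier similar_A]
  define p where "p v j = P $$ (v, j)" for v j
  have spectral: "complex_of_real (s u v) = (\<Sum>j<n. of_real (d j) * (p u j * cnj (p v j)))"
    if "u < n" "v < n" for u v
  proof -
    have "complex_of_real (s u v) = A $$ (u, v)" using that by (simp add: A_def)
    then show ?thesis using similarD(3) unitary_diag_entry[OF similarD(6) that] by (simp add: p_def)
  qed
  have norm: "(\<Sum>v<n. (cmod (p v j))\<^sup>2) = 1" if "j < n" for j
    unfolding p_def by (rule unitary_col_norm[OF similarD(6,2) that])
  have "complex_of_real (\<Sum>v<n. s v v) = (\<Sum>v<n. \<Sum>j<n. of_real (d j * (cmod (p v j))\<^sup>2))"
    unfolding of_real_sum of_real_mult complex_norm_square
    by (intro sum.cong refl) (simp add: spectral)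
  also have "\<dots> = complex_of_real (\<Sum>j<n. d j * (\<Sum>v<n. (cmod (p v j))\<^sup>2))"
    by (subst sum.swap) (simp add: sum_distrib_left)
  finally have trace: "(\<Sum>v<n. s v v) = (\<Sum>j<n. d j)"
    unfolding of_real_eq_iff using norm by simp
  show thesis
    by (rule that[OF energy_unitarily_similar_diag[OF similar_A, unfolded A_def] trace norm
          quad_form_eigenvectors[OF spectral]])
qed

definition dot :: "'a set \<Rightarrow> ('a \<Rightarrow> real) \<Rightarrow> ('a \<Rightarrow> real) \<Rightarrow> real" where
  "dot V x y = (\<Sum>v\<in>V. x v * y v)"

lemma dot_commute: "dot V x y = dot V y x"
  by (simp add: dot_def mult.commute)

lemma dot_self_nonneg: "0 \<le> dot V x x"
  by (simp add: dot_def sum_nonneg)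

lemma dot_sum_right: "dot V x (\<lambda>v. \<Sum>i\<in>I. c i * q i v) = (\<Sum>i\<in>I. c i * dot V x (q i))"
proof -
  have "dot V x (\<lambda>v. \<Sum>i\<in>I. c i * q i v) = (\<Sum>v\<in>V. \<Sum>i\<in>I. c i * (x v * q i v))"
    by (simp add: dot_def sum_distrib_left mult_ac)
  also have "\<dots> = (\<Sum>i\<in>I. c i * dot V x (q i))"
    by (subst sum.swap) (simp add: dot_def sum_distrib_left)
  finally show ?thesis .
qed

lemma bessel_inequality:
  fixes q :: "'i \<Rightarrow> 'a \<Rightarrow> real"
  assumes finite_I: "finite I" and orth: "pairwise (\<lambda>i j. dot V (q i) (q j) = 0) I"
  shows "(\<Sum>i\<in>I. (dot V (q i) x)\<^sup>2 / dot V (q i) (q i)) \<le> dot V x x"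
proof -
  define c where "c i = dot V (q i) x / dot V (q i) (q i)" for i
  define y where "y = (\<lambda>v. \<Sum>i\<in>I. c i * q i v)"
  have dot_q_y: "dot V (q i) y = c i * dot V (q i) (q i)" if in_I: "i \<in> I" for i
  proof -
    have "dot V (q i) y = (\<Sum>j\<in>I. if j = i then c i * dot V (q i) (q i) else 0)"
      unfolding y_def dot_sum_right
      by (intro sum.cong refl) (use in_I orth in \<open>auto simp: pairwise_def\<close>)
    then show ?thesis using finite_I in_I by simp
  qed
  have dot_x_y: "dot V x y = (\<Sum>i\<in>I. (dot V (q i) x)\<^sup>2 / dot V (q i) (q i))"
    unfolding y_def dot_sum_right by (simp add: c_def dot_commute[of V x] power2_eq_square)
  have "dot V y y = (\<Sum>i\<in>I. c i * dot V (q i) y)"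
    by (subst (2) y_def) (simp add: dot_sum_right dot_commute)
  also have "\<dots> = (\<Sum>i\<in>I. (dot V (q i) x)\<^sup>2 / dot V (q i) (q i))"
    by (intro sum.cong refl) (simp add: dot_q_y c_def power2_eq_square)
  finally have dot_y_y: "dot V y y = dot V x y" using dot_x_y by simp
  have "0 \<le> (\<Sum>v\<in>V. (x v - y v)\<^sup>2)" by (simp add: sum_nonneg)
  also have "\<dots> = dot V x x - 2 * dot V x y + dot V y y"
    by (simp add: dot_def power2_eq_square algebra_simps sum.distrib sum_subtractf sum_distrib_left)
  finally show ?thesis using dot_x_y dot_y_y by simp
qed

lemma bessel_inequality_complex:
  fixes q :: "'i \<Rightarrow> 'a \<Rightarrow> real" and p :: "'a \<Rightarrow> complex"
  assumes "finite I" "pairwise (\<lambda>i j. dot V (q i) (q j) = 0) I"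
  shows "(\<Sum>i\<in>I. (cmod (\<Sum>v\<in>V. of_real (q i v) * p v))\<^sup>2 / dot V (q i) (q i)) \<le> (\<Sum>v\<in>V. (cmod (p v))\<^sup>2)"
proof -
  have "(cmod (\<Sum>v\<in>V. of_real (q i v) * p v))\<^sup>2 =
      (dot V (q i) (\<lambda>v. Re (p v)))\<^sup>2 + (dot V (q i) (\<lambda>v. Im (p v)))\<^sup>2" for i
    by (simp add: cmod_power2 dot_def)
  then have "(\<Sum>i\<in>I. (cmod (\<Sum>v\<in>V. of_real (q i v) * p v))\<^sup>2 / dot V (q i) (q i)) =
      (\<Sum>i\<in>I. (dot V (q i) (\<lambda>v. Re (p v)))\<^sup>2 / dot V (q i) (q i)) +
      (\<Sum>i\<in>I. (dot V (q i) (\<lambda>v. Im (p v)))\<^sup>2 / dot V (q i) (q i))"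
    by (simp add: add_divide_distrib sum.distrib)
  also have "\<dots> \<le> dot V (\<lambda>v. Re (p v)) (\<lambda>v. Re (p v)) + dot V (\<lambda>v. Im (p v)) (\<lambda>v. Im (p v))"
    by (intro add_mono bessel_inequality assms)
  also have "\<dots> = (\<Sum>v\<in>V. (cmod (p v))\<^sup>2)"
    unfolding dot_def cmod_power2 by (simp add: sum.distrib power2_eq_square)
  finally show ?thesis .
qed

text \<open>Ky Fan's variational principle for the positive part of the spectrum, which carries
  \<open>(energy + trace) / 2\<close>. A zero vector contributes \<open>0 / 0 = 0\<close>.\<close>

lemma sum_rayleigh_quotients_le_energy:
  fixes s :: "nat \<Rightarrow> nat \<Rightarrow> real" and q :: "'i \<Rightarrow> nat \<Rightarrow> real"
  assumes sym: "\<And>u v. u < n \<Longrightarrow> v < n \<Longrightarrow> s u v = s v u"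
    and family: "finite I" "pairwise (\<lambda>i j. dot {..<n} (q i) (q j) = 0) I"
  shows "2 * (\<Sum>i\<in>I. quad_form n s (q i) / dot {..<n} (q i) (q i))
    \<le> energy (mat n n (\<lambda>(u, v). complex_of_real (s u v))) + (\<Sum>v<n. s v v)"
proof -
  obtain d p where energy: "energy (mat n n (\<lambda>(u, v). complex_of_real (s u v))) = (\<Sum>j<n. \<bar>d j\<bar>)"
    and trace: "(\<Sum>v<n. s v v) = (\<Sum>j<n. d j)"
    and norm: "\<And>j. j < n \<Longrightarrow> (\<Sum>v<n. (cmod (p v j))\<^sup>2) = 1"
    and form: "\<And>x. quad_form n s x = (\<Sum>j<n. d j * (cmod (\<Sum>v<n. of_real (x v) * p v j))\<^sup>2)"
    using real_symmetric_spectral_decomposition[of n s, OF sym] by blast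
  define w where "w i j = (cmod (\<Sum>v<n. of_real (q i v) * p v j))\<^sup>2 / dot {..<n} (q i) (q i)" for i j
  have weight: "0 \<le> (\<Sum>i\<in>I. w i j)" "(\<Sum>i\<in>I. w i j) \<le> 1" if "j < n" for j
    using bessel_inequality_complex[OF family, of "\<lambda>v. p v j"] norm[OF that]
    by (auto simp: w_def dot_self_nonneg intro!: sum_nonneg)
  have "(\<Sum>i\<in>I. quad_form n s (q i) / dot {..<n} (q i) (q i)) = (\<Sum>i\<in>I. \<Sum>j<n. d j * w i j)"
    unfolding form w_def by (simp add: sum_divide_distrib)
  also have "\<dots> = (\<Sum>j<n. d j * (\<Sum>i\<in>I. w i j))"
    by (subst sum.swap) (simp add: sum_distrib_left)
  also have "\<dots> \<le> (\<Sum>j<n. (\<bar>d j\<bar> + d j) / 2)"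
  proof (rule sum_mono)
    fix j assume "j \<in> {..<n}"
    then show "d j * (\<Sum>i\<in>I. w i j) \<le> (\<bar>d j\<bar> + d j) / 2"
      using weight[of j] by (cases "d j \<ge> 0") (auto simp: mult_left_le mult_nonpos_nonneg)
  qed
  finally show ?thesis
    unfolding energy trace by (simp add: sum_divide_distrib[symmetric] sum.distrib)
qed

section \<open>Rayleigh quotients of the Seidel matrix\<close>

definition edge_form :: "'a set \<Rightarrow> ('a \<Rightarrow> 'a \<Rightarrow> bool) \<Rightarrow> ('a \<Rightarrow> real) \<Rightarrow> real" where
  "edge_form V E x = (\<Sum>u\<in>V. \<Sum>v\<in>V. of_bool (E u v) * (x u * x v))"

text \<open>The Rayleigh quotient of \<open>J - 2 A\<close>, the Seidel matrix shifted by the identity.\<close>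

definition rayleigh :: "'a set \<Rightarrow> ('a \<Rightarrow> 'a \<Rightarrow> bool) \<Rightarrow> ('a \<Rightarrow> real) \<Rightarrow> real" where
  "rayleigh V E x = ((sum x V)\<^sup>2 - 2 * edge_form V E x) / dot V x x"

lemma edge_form_support:
  assumes subset: "finite V" "F \<subseteq> V" and zero_outside: "\<And>v. v \<in> V - F \<Longrightarrow> x v = 0"
  shows "edge_form V E x = edge_form F E x"
proof -
  have "(\<Sum>v\<in>V. of_bool (E u v) * (x u * x v)) = (\<Sum>v\<in>F. of_bool (E u v) * (x u * x v))" for u
    by (rule sum.mono_neutral_right) (use subset zero_outside in auto)
  then have "edge_form V E x = (\<Sum>u\<in>V. \<Sum>v\<in>F. of_bool (E u v) * (x u * x v))"
    by (simp add: edge_form_def)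
  also have "\<dots> = edge_form F E x"
    unfolding edge_form_def by (rule sum.mono_neutral_right) (use subset zero_outside in auto)
  finally show ?thesis .
qed

lemma dot_support:
  assumes "finite V" "F \<subseteq> V" "\<And>v. v \<in> V - F \<Longrightarrow> x v = 0"
  shows "dot V x y = dot F x y"
  unfolding dot_def by (rule sum.mono_neutral_right) (use assms in auto)

lemma rayleigh_support:
  assumes "finite V" "F \<subseteq> V" "\<And>v. v \<in> V - F \<Longrightarrow> x v = 0"
  shows "rayleigh V E x = rayleigh F E x"
proof -
  have "sum x V = sum x F" by (rule sum.mono_neutral_right) (use assms in auto)
  moreover have "edge_form V E x = edge_form F E x" by (rule edge_form_support[OF assms])
  moreover have "dot V x x = dot F x x" by (rule dot_support[OF assms])
  ultimately show ?thesis by (simp add: rayleigh_def)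
qed

lemma rayleigh_independent_set:
  assumes subset: "finite V" "X \<subseteq> V" and indep: "\<And>u v. u \<in> X \<Longrightarrow> v \<in> X \<Longrightarrow> \<not> E u v"
  shows "rayleigh V E (\<lambda>v. of_bool (v \<in> X)) = real (card X)"
proof -
  have "rayleigh V E (\<lambda>v. of_bool (v \<in> X)) = rayleigh X E (\<lambda>v. of_bool (v \<in> X))"
    by (rule rayleigh_support[OF subset]) simp
  also have "edge_form X E (\<lambda>v. of_bool (v \<in> X)) = 0"
    unfolding edge_form_def using indep by (intro sum.neutral ballI) auto
  then have "rayleigh X E (\<lambda>v. of_bool (v \<in> X)) = real (card X)"
    by (simp add: rayleigh_def dot_def power2_eq_square)
  finally show ?thesis .
qed

lemma edge_form_le_oriented:
  assumes finite_V: "finite V" and sym: "\<And>u v. E u v \<Longrightarrow> E v u"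
    and orient: "\<And>u v. E u v \<Longrightarrow> p u = v \<or> p v = u"
    and nonneg: "\<And>v. v \<in> V \<Longrightarrow> 0 \<le> x v"
  shows "edge_form V E x \<le> (\<Sum>u | u \<in> V \<and> p u \<in> V \<and> E u (p u). 2 * x u * x (p u))"
proof -
  define t where "t u v = of_bool (p u = v \<and> E u v) * (x u * x v)" for u v
  have "edge_form V E x \<le> (\<Sum>u\<in>V. \<Sum>v\<in>V. t u v + t v u)"
    unfolding edge_form_def
  proof (intro sum_mono)
    fix u v assume "u \<in> V" "v \<in> V"
    then show "of_bool (E u v) * (x u * x v) \<le> t u v + t v u"
      using orient[of u v] sym[of u v] nonneg by (auto simp: t_def mult.commute)
  qed
  also have "\<dots> = (\<Sum>u\<in>V. \<Sum>v\<in>V. t u v) + (\<Sum>u\<in>V. \<Sum>v\<in>V. t u v)"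
    using sum.swap[of "\<lambda>u v. t v u" V V] by (simp add: sum.distrib)
  also have "(\<Sum>u\<in>V. \<Sum>v\<in>V. t u v) = (\<Sum>u\<in>V. if p u \<in> V \<and> E u (p u) then x u * x (p u) else 0)"
  proof (intro sum.cong refl)
    fix u
    have "(\<Sum>v\<in>V. t u v) = (\<Sum>v\<in>V. if v = p u then of_bool (E u (p u)) * (x u * x (p u)) else 0)"
      by (intro sum.cong refl) (auto simp: t_def)
    then show "(\<Sum>v\<in>V. t u v) = (if p u \<in> V \<and> E u (p u) then x u * x (p u) else 0)"
      using finite_V by auto
  qed
  also have "\<dots> = (\<Sum>u | u \<in> V \<and> p u \<in> V \<and> E u (p u). x u * x (p u))"
    using finite_V by (simp add: sum.inter_filter)
  finally show ?thesis by (simp add: sum_distrib_left[symmetric] mult.assoc)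
qed

lemma edge_form_partition:
  assumes finite_V: "finite V" and partition: "partition_on V P"
  shows "edge_form V E x =
    (\<Sum>B\<in>P. edge_form B E x) + edge_form V (\<lambda>u v. E u v \<and> (\<forall>B\<in>P. u \<in> B \<longrightarrow> v \<notin> B)) x"
proof -
  let ?cross = "\<lambda>u v. E u v \<and> (\<forall>B\<in>P. u \<in> B \<longrightarrow> v \<notin> B)"
  let ?inner = "\<lambda>u v. E u v \<and> (\<exists>B\<in>P. u \<in> B \<and> v \<in> B)"
  have "edge_form V E x = edge_form V ?inner x + edge_form V ?cross x"
    unfolding edge_form_def sum.distrib[symmetric] by (intro sum.cong refl) auto
  also have "edge_form V ?inner x = (\<Sum>B\<in>P. \<Sum>u\<in>B. \<Sum>v\<in>V. of_bool (?inner u v) * (x u * x v))"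
    unfolding edge_form_def by (rule sum.partition[OF finite_V partition])
  also have "\<dots> = (\<Sum>B\<in>P. edge_form B E x)"
    unfolding edge_form_def
  proof ((rule sum.cong[OF refl])+)
    fix B u assume in_block: "B \<in> P" "u \<in> B"
    then have "B \<subseteq> V" using partition by (auto simp: partition_on_def)
    moreover have "?inner u v \<longleftrightarrow> E u v \<and> v \<in> B" for v
      using partition_onD2[OF partition] in_block unfolding disjoint_def by blast
    ultimately show "(\<Sum>v\<in>V. of_bool (?inner u v) * (x u * x v)) =
        (\<Sum>v\<in>B. of_bool (E u v) * (x u * x v))"
      using finite_V by (intro sum.mono_neutral_cong_right) auto
  qed
  finally show ?thesis .
qed

locale finite_graph =
  fixes n :: nat and E :: "nat \<Rightarrow> nat \<Rightarrow> bool"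
  assumes graph: "simple_graph n E"
begin

lemma edge_less: "E u v \<Longrightarrow> u < n" "E u v \<Longrightarrow> v < n"
  using graph unfolding simple_graph_def by blast+

lemma edge_sym: "E u v \<Longrightarrow> E v u"
  using graph unfolding simple_graph_def by blast

lemma edge_irrefl [simp]: "\<not> E u u"
  using graph unfolding simple_graph_def by blast

lemma finite_nbrs [simp]: "finite {v. E u v}"
  by (rule finite_subset[of _ "{..<n}"]) (auto dest: edge_less)

lemma quad_form_seidel:
  "quad_form n (\<lambda>u v. if u = v then 0 else if E u v then -1 else 1) x =
    (\<Sum>v<n. x v)\<^sup>2 - dot {..<n} x x - 2 * edge_form {..<n} E x"
proof -
  have "quad_form n (\<lambda>u v. if u = v then 0 else if E u v then -1 else 1) x =
      (\<Sum>u<n. \<Sum>v<n.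
        x u * x v - (if v = u then x u * x v else 0) - 2 * (of_bool (E u v) * (x u * x v)))"
    unfolding quad_form_def by (intro sum.cong refl) auto
  also have "\<dots> = (\<Sum>u<n. \<Sum>v<n. x u * x v) - (\<Sum>u<n. x u * x u) - 2 * edge_form {..<n} E x"
    unfolding sum_subtractf edge_form_def sum_distrib_left by simp
  finally show ?thesis by (simp add: power2_eq_square sum_product dot_def)
qed

lemma energy_ge_sum_rayleigh:
  fixes q :: "'i \<Rightarrow> nat \<Rightarrow> real"
  assumes family: "finite I" "pairwise (\<lambda>i j. dot {..<n} (q i) (q j) = 0) I"
  shows "(\<Sum>i\<in>I. 2 * (rayleigh {..<n} E (q i) - 1)) \<le> energy (seidel_matrix n E)"
proof -
  define s :: "nat \<Rightarrow> nat \<Rightarrow> real" where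
    "s = (\<lambda>u v. if u = v then 0 else if E u v then -1 else 1)"
  have seidel: "seidel_matrix n E = mat n n (\<lambda>(u, v). complex_of_real (s u v))"
    unfolding seidel_matrix_def s_def by (rule eq_matI) auto
  have "rayleigh {..<n} E (q i) - 1 \<le> quad_form n s (q i) / dot {..<n} (q i) (q i)" for i
    unfolding s_def quad_form_seidel rayleigh_def
    by (cases "dot {..<n} (q i) (q i) = 0") (simp_all add: field_simps)
  then have "(\<Sum>i\<in>I. 2 * (rayleigh {..<n} E (q i) - 1)) \<le>
      2 * (\<Sum>i\<in>I. quad_form n s (q i) / dot {..<n} (q i) (q i))"
    unfolding sum_distrib_left by (intro sum_mono mult_left_mono) auto
  also have "\<dots> \<le> energy (seidel_matrix n E) + (\<Sum>v<n. s v v)"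
    unfolding seidel
    by (intro sum_rayleigh_quotients_le_energy family) (auto simp: s_def dest: edge_sym)
  finally show ?thesis by (simp add: s_def)
qed

definition alternating_vec :: "nat \<Rightarrow> nat \<Rightarrow> nat \<Rightarrow> nat \<Rightarrow> nat \<Rightarrow> real" where
  "alternating_vec a b c d v = (if v = a \<or> v = d then 1 else if v = b \<or> v = c then -1 else 0)"

lemma dot_alternating_vec:
  assumes "distinct [a, b, c, d]" "{a, b, c, d} \<subseteq> {..<n}"
  shows "dot {..<n} (alternating_vec a b c d) f = f a - f b - f c + f d"
proof -
  have "dot {..<n} (alternating_vec a b c d) f = dot {a, b, c, d} (alternating_vec a b c d) f"
    by (rule dot_support) (use assms in \<open>auto simp: alternating_vec_def\<close>)
  then show ?thesis using assms(1) by (auto simp: dot_def alternating_vec_def)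
qed

lemma rayleigh_alternating_vec:
  assumes distinct: "distinct [a, b, c, d]" and edges: "E a b" "E c d"
    and induced: "\<not> E a c" "\<not> E a d" "\<not> E b c" "\<not> E b d"
  shows "rayleigh {..<n} E (alternating_vec a b c d) = 2"
proof -
  let ?w = "alternating_vec a b c d" and ?F = "{a, b, c, d}"
  have "rayleigh {..<n} E ?w = rayleigh ?F E ?w"
    by (rule rayleigh_support) (use edges edge_less in \<open>auto simp: alternating_vec_def\<close>)
  moreover have vals: "?w a = 1" "?w b = -1" "?w c = -1" "?w d = 1"
    using distinct by (auto simp: alternating_vec_def)
  have "E b a" "E d c" "\<not> E c a" "\<not> E d a" "\<not> E c b" "\<not> E d b"
    using edges induced edge_sym by blast+
  then have "edge_form ?F E ?w = - 4"
    unfolding edge_form_def using distinct edges induced by (simp add: vals)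
  moreover have "sum ?w ?F = 0" "dot ?F ?w ?w = 4" using distinct by (simp_all add: vals dot_def)
  ultimately show ?thesis by (simp add: rayleigh_def)
qed

text \<open>The indicators of the colour classes contribute \<open>2 n - 4\<close>, and an alternating sign pattern
  on the two edges, which is orthogonal to them, contributes \<open>2\<close>.\<close>

lemma energy_ge_bipartite_induced_2K2:
  assumes black: "\<And>u v. E u v \<Longrightarrow> black u \<noteq> (black v :: bool)"
    and edges: "E a b" "E c d" "black a = black c" "a \<noteq> c" "b \<noteq> d" and induced: "\<not> E a d" "\<not> E c b"
  shows "energy (seidel_matrix n E) \<ge> 2 * real n - 2"
proof -
  define w where "w = alternating_vec a b c d"
  define X where "X k = {v. v < n \<and> black v = k}" for k
  define q where "q i = (case i of None \<Rightarrow> w | Some k \<Rightarrow> (\<lambda>v. of_bool (v \<in> X k)))" for i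
  have colours: "black b = (\<not> black a)" "black d = (\<not> black a)" "black c = black a"
    using black edges by metis+
  then have distinct: "distinct [a, b, c, d]" using edges(4,5) by auto
  have less: "a < n" "b < n" "c < n" "d < n"
    using edge_less[OF edges(1)] edge_less[OF edges(2)] by auto
  have "\<not> E a c" "\<not> E b d" using black[of a c] black[of b d] colours by auto
  moreover have "\<not> E b c" using induced(2) edge_sym by blast
  ultimately have ray_w: "rayleigh {..<n} E w = 2"
    unfolding w_def by (intro rayleigh_alternating_vec distinct edges(1,2) induced(1))
  have ray_X: "rayleigh {..<n} E (\<lambda>v. of_bool (v \<in> X k)) = real (card (X k))" for k
    by (rule rayleigh_independent_set) (auto simp: X_def dest: black)
  have "card (X True \<union> X False) = card (X True) + card (X False)"
    by (rule card_Un_disjoint) (auto simp: X_def)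
  moreover have "X True \<union> X False = {..<n}" by (auto simp: X_def)
  ultimately have n_eq: "real n = real (card (X True)) + real (card (X False))"
    by (simp flip: of_nat_add)
  have orth_w: "dot {..<n} w (\<lambda>v. of_bool (v \<in> X k)) = 0" for k
    unfolding w_def using dot_alternating_vec[OF distinct] less colours by (simp add: X_def)
  then have orth_w': "dot {..<n} (\<lambda>v. of_bool (v \<in> X k)) w = 0" for k
    by (subst dot_commute)
  have orth_X: "dot {..<n} (\<lambda>v. of_bool (v \<in> X k)) (\<lambda>v. of_bool (v \<in> X l)) = 0" if "k \<noteq> l" for k l
    unfolding dot_def by (intro sum.neutral) (use that in \<open>auto simp: X_def\<close>)
  have "(\<Sum>i\<in>UNIV. 2 * (rayleigh {..<n} E (q i) - 1)) \<le> energy (seidel_matrix n E)"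
  proof (intro energy_ge_sum_rayleigh pairwiseI)
    show "dot {..<n} (q i) (q j) = 0" if "i \<noteq> j" for i j
      using that orth_w orth_w' orth_X by (cases i; cases j) (auto simp: q_def)
  qed simp
  then show ?thesis
    by (simp add: UNIV_option_conv UNIV_bool q_def ray_w ray_X n_eq)
qed

end

section \<open>Trees\<close>

lemma is_cycle_chord:
  assumes path: "distinct (x # ys)" "successively E (x # ys)"
    and chord: "k < length ys" "k \<ge> 1" "E (ys ! k) x"
  shows "is_cycle E (take (Suc (Suc k)) (x # ys))" (is "is_cycle E ?c")
proof -
  have length_cycle: "length ?c = Suc (Suc k)" using chord(1) by simp
  show ?thesis
    unfolding is_cycle_def
  proof (intro conjI allI impI)
    fix i assume "Suc i < length ?c"
    then have less: "Suc i < length (x # ys)" "Suc i < Suc (Suc k)" using length_cycle by auto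
    then have "E ((x # ys) ! i) ((x # ys) ! Suc i)"
      using path(2) by (auto simp: successively_conv_nth)
    then show "E (?c ! i) (?c ! Suc i)" using less by (simp only: nth_take Suc_lessD)
  next
    have "last ?c = ?c ! Suc k" using length_cycle by (subst last_conv_nth) auto
    also have "\<dots> = ys ! k" using chord(1) by simp
    finally show "E (last ?c) (hd ?c)" using chord(3) by simp
  qed (use path length_cycle chord in \<open>auto dest: in_set_takeD\<close>)
qed

locale forest =
  fixes E :: "nat \<Rightarrow> nat \<Rightarrow> bool"
  assumes sym: "E u v \<Longrightarrow> E v u" and irrefl [simp]: "\<not> E u u" and acyclic: "\<not> is_cycle E vs"
begin

text \<open>An end of a longest path has at most one neighbour.\<close>

lemma acyclic_ex_leaf:
  assumes finite_nonempty: "finite V" "V \<noteq> {}"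
  shows "\<exists>x\<in>V. \<exists>y. \<forall>z\<in>V. E x z \<longrightarrow> z = y"
proof (rule ccontr)
  assume no_leaf: "\<not> ?thesis"
  define path where "path xs \<longleftrightarrow> xs \<noteq> [] \<and> distinct xs \<and> set xs \<subseteq> V \<and> successively E xs" for xs
  obtain x0 where "x0 \<in> V" using finite_nonempty by blast
  then have "path [x0]" by (simp add: path_def)
  moreover have "length xs < Suc (card V)" if "path xs" for xs
    using that finite_nonempty card_mono[of V "set xs"]
    by (simp add: path_def distinct_card less_Suc_eq_le)
  ultimately obtain xs where path_xs: "path xs" and longest: "\<And>ys. path ys \<Longrightarrow> length ys \<le> length xs"
    using ex_has_greatest_nat[of path "[x0]" length "Suc (card V)"] by blast
  obtain x ys where xs_eq: "xs = x # ys" using path_xs by (cases xs) (auto simp: path_def)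
  have neighbour_in_path: "y \<in> set ys" if "y \<in> V" "E x y" for y
  proof (rule ccontr)
    assume "y \<notin> set ys"
    then have "path (y # xs)"
      using path_xs that sym[OF that(2)] unfolding path_def xs_eq by (auto simp: successively_Cons)
    then show False using longest[of "y # xs"] by simp
  qed
  have "x \<in> V" using path_xs by (simp add: path_def xs_eq)
  then obtain z where second_neighbour: "z \<in> V" "E x z" "z \<noteq> ys ! 0" using no_leaf by blast
  then obtain k where index: "k < length ys" "ys ! k = z"
    using neighbour_in_path by (metis in_set_conv_nth)
  with second_neighbour have "k \<ge> 1" by (cases k) auto
  then have "is_cycle E (take (Suc (Suc k)) (x # ys))"
    using path_xs index sym[OF second_neighbour(2)]
    by (intro is_cycle_chord) (auto simp: path_def xs_eq)
  then show False using acyclic by blast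
qed

lemma forest_induct [consumes 1, case_names empty leaf]:
  assumes finite_V: "finite V" and empty: "Q {}"
    and leaf: "\<And>V x y. finite V \<Longrightarrow> x \<in> V \<Longrightarrow> (\<And>z. z \<in> V \<Longrightarrow> E x z \<Longrightarrow> z = y) \<Longrightarrow> Q (V - {x}) \<Longrightarrow> Q V"
  shows "Q V"
  using finite_V
proof (induction V rule: finite_remove_induct)
  case empty
  then show ?case by (rule \<open>Q {}\<close>)
next
  case (remove V)
  obtain x y where leaf_x: "x \<in> V" "\<And>z. z \<in> V \<Longrightarrow> E x z \<Longrightarrow> z = y"
    using acyclic_ex_leaf[OF remove.hyps(1,2)] by blast
  show ?case by (rule leaf[OF remove.hyps(1) leaf_x remove.IH[OF leaf_x(1)]])
qed

lemma forest_colouring: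
  assumes "finite V"
  shows "\<exists>black :: nat \<Rightarrow> bool. \<forall>u\<in>V. \<forall>v\<in>V. E u v \<longrightarrow> black u \<noteq> black v"
  using assms
proof (induction V rule: forest_induct)
  case (leaf V x y)
  obtain black :: "nat \<Rightarrow> bool" where black: "\<forall>u\<in>V - {x}. \<forall>v\<in>V - {x}. E u v \<longrightarrow> black u \<noteq> black v"
    using leaf.IH by blast
  have "(black(x := \<not> black y)) u \<noteq> (black(x := \<not> black y)) v" if "u \<in> V" "v \<in> V" "E u v" for u v
  proof (cases "u = x \<or> v = x")
    case True
    then have "u = x \<and> v = y \<or> v = x \<and> u = y" "u \<noteq> v"
      using that sym irrefl leaf.hyps(3) by blast+
    then show ?thesis by auto
  next
    case False
    then show ?thesis using that black by simp
  qed
  then show ?case by blast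
qed simp

lemma forest_orientation:
  assumes "finite V"
  shows "\<exists>p :: nat \<Rightarrow> nat. \<forall>u\<in>V. \<forall>v\<in>V. E u v \<longrightarrow> p u = v \<or> p v = u"
  using assms
proof (induction V rule: forest_induct)
  case (leaf V x y)
  obtain p where oriented: "\<forall>u\<in>V - {x}. \<forall>v\<in>V - {x}. E u v \<longrightarrow> p u = v \<or> p v = u"
    using leaf.IH by blast
  have "(p(x := y)) u = v \<or> (p(x := y)) v = u" if "u \<in> V" "v \<in> V" "E u v" for u v
  proof (cases "u = x \<or> v = x")
    case True
    then have "u = x \<and> v = y \<or> v = x \<and> u = y" "u \<noteq> v"
      using that sym irrefl leaf.hyps(3) by blast+
    then show ?thesis by auto
  next
    case False
    then show ?thesis using that oriented by simp
  qed
  then show ?case by blast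
qed simp

end

locale finite_tree =
  fixes n :: nat and E :: "nat \<Rightarrow> nat \<Rightarrow> bool"
  assumes tree: "is_tree n E"

sublocale finite_tree \<subseteq> finite_graph
  using tree by unfold_locales (simp add: is_tree_def)

sublocale finite_tree \<subseteq> forest E
proof unfold_locales
  show "E u v \<Longrightarrow> E v u" for u v by (rule edge_sym)
  show "\<not> is_cycle E vs" for vs using tree by (simp add: is_tree_def)
qed simp

context finite_tree
begin

lemma no_triangle: "E a b \<Longrightarrow> E b c \<Longrightarrow> E c a \<Longrightarrow> False"
  using acyclic[of "[a, b, c]"]
  by (auto simp: is_cycle_def nth_Cons less_Suc_eq numeral_3_eq_3 split: nat.splits)

lemma no_square: "E a b \<Longrightarrow> E b c \<Longrightarrow> E c d \<Longrightarrow> E d a \<Longrightarrow> a = c \<or> b = d"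
  using acyclic[of "[a, b, c, d]"]
  by (auto simp: is_cycle_def nth_Cons less_Suc_eq numeral_3_eq_3 split: nat.splits)

lemma no_pentagon:
  "E a b \<Longrightarrow> E b c \<Longrightarrow> E c d \<Longrightarrow> E d e \<Longrightarrow> E e a \<Longrightarrow> \<not> distinct [a, b, c, d, e]"
  using acyclic[of "[a, b, c, d, e]"]
  by (auto simp: is_cycle_def nth_Cons less_Suc_eq numeral_3_eq_3 split: nat.splits)

lemma colouring:
  obtains black :: "nat \<Rightarrow> bool" where "\<And>u v. E u v \<Longrightarrow> black u \<noteq> black v"
  using forest_colouring[of "{..<n}"] edge_less
  by (metis finite_lessThan lessThan_iff)

lemma orientation:
  obtains p where "\<And>u v. E u v \<Longrightarrow> p u = v \<or> p v = u"
  using forest_orientation[of "{..<n}"] edge_less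
  by (metis finite_lessThan lessThan_iff)

lemma closed_set_all:
  assumes "c < n" "c \<in> S" "\<And>u v. u \<in> S \<Longrightarrow> E u v \<Longrightarrow> v \<in> S"
  shows "{..<n} \<subseteq> S"
proof
  fix v assume "v \<in> {..<n}"
  then have "E\<^sup>*\<^sup>* c v"
    using tree assms(1) unfolding is_tree_def connected_graph_def by blast
  then show "v \<in> S" by (induction rule: rtranclp_induct) (use assms in auto)
qed

lemma ex_neighbour:
  assumes "n \<ge> 2" "v < n"
  obtains u where "E v u"
proof -
  have "\<exists>u. E v u"
  proof (rule ccontr)
    assume "\<nexists>u. E v u"
    then have "{..<n} \<subseteq> {v}" using closed_set_all[of v "{v}"] assms by blast
    then show False using card_mono[of "{v}" "{..<n}"] assms by simp
  qed
  then show thesis using that by blast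
qed

lemma is_leafI:
  assumes "E u v" "\<And>w. E u w \<Longrightarrow> w = v"
  shows "is_leaf n E u"
proof -
  have "{w. w < n \<and> E u w} = {v}" using assms edge_less by blast
  then show ?thesis using edge_less(1)[OF assms(1)] by (simp add: is_leaf_def degree_def)
qed

lemma max_leaf_nbrs_ge:
  assumes "w < n"
  shows "card {u. u < n \<and> E w u \<and> is_leaf n E u} \<le> max_leaf_nbrs n E"
  unfolding max_leaf_nbrs_def using assms by (intro Max_ge) auto

lemma max_leaf_nbrs_pos:
  assumes "n \<ge> 2"
  shows "max_leaf_nbrs n E \<ge> 1"
proof -
  obtain x y where leaf_x: "x < n" "\<And>z. E x z \<Longrightarrow> z = y"
    using acyclic_ex_leaf[of "{..<n}"] assms edge_less
    by (metis finite_lessThan lessThan_empty_iff lessThan_iff not_numeral_le_zero)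
  then have edge_xy: "E x y" using ex_neighbour[OF assms leaf_x(1)] by metis
  then have "is_leaf n E x" using leaf_x by (intro is_leafI) auto
  then have "{x} \<subseteq> {u. u < n \<and> E y u \<and> is_leaf n E u}" using leaf_x(1) edge_sym[OF edge_xy] by auto
  then have "1 \<le> card {u. u < n \<and> E y u \<and> is_leaf n E u}"
    using card_mono[of "{u. u < n \<and> E y u \<and> is_leaf n E u}" "{x}"] by simp
  also have "\<dots> \<le> max_leaf_nbrs n E" by (rule max_leaf_nbrs_ge[OF edge_less(2)[OF edge_xy]])
  finally show ?thesis .
qed

definition star_centre :: "nat set \<Rightarrow> nat \<Rightarrow> bool" where
  "star_centre B c \<longleftrightarrow> c \<in> B \<and> (\<forall>x\<in>B - {c}. E c x)"

lemma star_edge_iff: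
  assumes "star_centre B c" "u \<in> B" "v \<in> B"
  shows "E u v \<longleftrightarrow> u \<noteq> v \<and> (u = c \<or> v = c)"
proof (cases "u = c \<or> v = c")
  case True
  then show ?thesis using assms edge_sym by (auto simp: star_centre_def)
next
  case False
  then have "E c u" "E c v" using assms by (auto simp: star_centre_def)
  then show ?thesis using False no_triangle[of c u v] edge_sym by blast
qed

lemma edge_form_star:
  assumes star: "finite B" "star_centre B c" and leaf: "\<And>v. v \<in> B - {c} \<Longrightarrow> x v = b"
  shows "edge_form B E x = 2 * real (card B - 1) * x c * b"
proof -
  have centre_in: "c \<in> B" using star by (simp add: star_centre_def)
  have centre_row: "(\<Sum>v\<in>B. of_bool (E c v) * (x c * x v)) = (\<Sum>v\<in>B - {c}. x c * b)"
    unfolding sum.remove[OF star(1) centre_in]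
    using star_edge_iff[OF star(2) centre_in] leaf by simp
  have leaf_row: "(\<Sum>v\<in>B. of_bool (E u v) * (x u * x v)) = x c * b" if leaf_u: "u \<in> B - {c}" for u
  proof -
    have "(\<Sum>v\<in>B. of_bool (E u v) * (x u * x v)) = (\<Sum>v\<in>B. if v = c then x u * x v else 0)"
      using star_edge_iff[OF star(2)] leaf_u by (intro sum.cong refl) auto
    then show ?thesis using star(1) centre_in leaf[OF leaf_u] by simp
  qed
  have "edge_form B E x = (\<Sum>v\<in>B. of_bool (E c v) * (x c * x v)) +
      (\<Sum>u\<in>B - {c}. \<Sum>v\<in>B. of_bool (E u v) * (x u * x v))"
    unfolding edge_form_def by (rule sum.remove[OF star(1) centre_in])
  also have "\<dots> = (\<Sum>u\<in>B - {c}. x c * b) + (\<Sum>u\<in>B - {c}. x c * b)"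
    by (simp only: centre_row leaf_row cong: sum.cong)
  finally show ?thesis using star(1) centre_in by simp
qed

end

lemma sum_eq_off_point:
  fixes f :: "'a \<Rightarrow> real"
  assumes "finite B" "c \<in> B" "\<And>v. v \<in> B - {c} \<Longrightarrow> f v = b"
  shows "sum f B = f c + real (card B - 1) * b"
  using assms sum.remove[of B c f] by simp

section \<open>The bound \<open>2 n - 2\<close>\<close>

lemma edge_form_single_edge:
  assumes "finite V" "a \<in> V" "b \<in> V" "a \<noteq> b"
  shows "edge_form V (\<lambda>u v. u = a \<and> v = b \<or> u = b \<and> v = a) x = 2 * x a * x b"
proof -
  have "edge_form V (\<lambda>u v. u = a \<and> v = b \<or> u = b \<and> v = a) x =
      (\<Sum>u\<in>V. \<Sum>v\<in>V. (if v = b then if u = a then x a * x b else 0 else 0) +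
        (if v = a then if u = b then x a * x b else 0 else 0))"
    unfolding edge_form_def using assms(4) by (intro sum.cong refl) auto
  then show ?thesis using assms by (simp add: sum.distrib)
qed

context finite_tree
begin

lemma energy_ge_star:
  assumes star: "star_centre {..<n} c"
  shows "energy (seidel_matrix n E) \<ge> 2 * real n - 2"
proof -
  define q :: "nat \<Rightarrow> real" where "q v = (if v = c then -1 else 1)" for v
  have centre_in: "c \<in> {..<n}" using star by (simp add: star_centre_def)
  then have n_pos: "real (n - Suc 0) = real n - 1" "n > 0" by auto
  have "sum q {..<n} = q c + real (card {..<n} - 1) * 1"
    by (rule sum_eq_off_point) (use centre_in in \<open>auto simp: q_def\<close>)
  then have total: "sum q {..<n} = real n - 2" by (simp add: q_def n_pos)
  have "q v * q v = 1" for v by (simp add: q_def)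
  then have norm: "dot {..<n} q q = real n" by (simp add: dot_def)
  have "edge_form {..<n} E q = 2 * real (card {..<n} - 1) * q c * 1"
    by (rule edge_form_star[OF _ star]) (auto simp: q_def)
  then have form: "edge_form {..<n} E q = - 2 * (real n - 1)" by (simp add: q_def n_pos)
  have "(real n - 2)\<^sup>2 - 2 * (- 2 * (real n - 1)) = real n * real n"
    by (simp add: power2_eq_square algebra_simps)
  then have "rayleigh {..<n} E q = real n"
    unfolding rayleigh_def total norm form using n_pos by simp
  then show ?thesis
    using energy_ge_sum_rayleigh[of "{()}" "\<lambda>_. q"] by (simp add: pairwise_def)
qed

lemma edge_between_adjacent_stars:
  assumes stars: "star_centre B c" "star_centre C d" "B \<inter> C = {}" "E c d"
    and edge_uv: "u \<in> B" "v \<in> C" "E u v"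
  shows "u = c \<and> v = d"
proof -
  have ends: "u = c \<or> E c u" "v = d \<or> E v d" "c \<in> B" "d \<in> C"
    using stars(1,2) edge_uv(1,2) edge_sym by (auto simp: star_centre_def)
  have "c \<noteq> v" "u \<noteq> d" using stars(3) ends(3,4) edge_uv(1,2) by auto
  then show ?thesis
    using ends(1,2) no_triangle[of c u d] no_triangle[of c v d] no_square[of c u v d]
      edge_sym[OF stars(4)] edge_uv(3) by blast
qed

definition double_star :: "nat set \<Rightarrow> nat \<Rightarrow> nat set \<Rightarrow> nat \<Rightarrow> bool" where
  "double_star B c C d \<longleftrightarrow> star_centre B c \<and> star_centre C d \<and> E c d \<and>
    B \<inter> C = {} \<and> B \<union> C = {..<n} \<and> card B \<ge> 2 \<and> card C \<ge> 2"

lemma edge_form_double_star: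
  assumes double: "double_star B c C d"
  shows "edge_form {..<n} E x = edge_form B E x + edge_form C E x + 2 * x c * x d"
proof -
  have stars: "star_centre B c" "star_centre C d" "B \<inter> C = {}" "E c d" and cover: "B \<union> C = {..<n}"
    using double by (auto simp: double_star_def)
  have centres_in: "c \<in> B" "d \<in> C" using stars by (auto simp: star_centre_def)
  have distinct: "c \<noteq> d" "B \<noteq> C" using centres_in stars(3) by auto
  have cross: "(\<lambda>u v. E u v \<and> (\<forall>X\<in>{B, C}. u \<in> X \<longrightarrow> v \<notin> X)) = (\<lambda>u v. u = c \<and> v = d \<or> u = d \<and> v = c)"
  proof (intro ext iffI)
    fix u v assume cross_uv: "E u v \<and> (\<forall>X\<in>{B, C}. u \<in> X \<longrightarrow> v \<notin> X)"
    then have "u \<in> B \<union> C" "v \<in> B \<union> C" using edge_less[of u v] cover by auto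
    then have "u \<in> B \<and> v \<in> C \<or> v \<in> B \<and> u \<in> C" using cross_uv by auto
    then show "u = c \<and> v = d \<or> u = d \<and> v = c"
      using edge_between_adjacent_stars[OF stars, of u v]
        edge_between_adjacent_stars[OF stars, of v u]
        cross_uv edge_sym[of u v] by blast
  next
    fix u v assume "u = c \<and> v = d \<or> u = d \<and> v = c"
    then show "E u v \<and> (\<forall>X\<in>{B, C}. u \<in> X \<longrightarrow> v \<notin> X)"
      using stars(3) edge_sym[OF stars(4)] stars(4) centres_in by auto
  qed
  have partition: "partition_on {..<n} {B, C}"
    using cover centres_in stars(3) by (auto simp: partition_on_def disjoint_def)
  have "edge_form {..<n} E x = (\<Sum>X\<in>{B, C}. edge_form X E x) +
      edge_form {..<n} (\<lambda>u v. u = c \<and> v = d \<or> u = d \<and> v = c) x"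
    unfolding edge_form_partition[OF finite_lessThan partition, of E] cross ..
  also have "edge_form {..<n} (\<lambda>u v. u = c \<and> v = d \<or> u = d \<and> v = c) x = 2 * x c * x d"
    using cover centres_in distinct by (intro edge_form_single_edge) auto
  finally show ?thesis using distinct by simp
qed

lemma sum_double_star:
  fixes f :: "nat \<Rightarrow> real"
  assumes double: "double_star B c C d"
    and leaf: "\<And>v. v \<in> B - {c} \<Longrightarrow> f v = a" "\<And>v. v \<in> C - {d} \<Longrightarrow> f v = b"
  shows "sum f {..<n} = f c + real (card B - 1) * a + (f d + real (card C - 1) * b)"
proof -
  have stars: "star_centre B c" "star_centre C d" and disjoint: "B \<inter> C = {}"
    and cover: "B \<union> C = {..<n}"
    using double by (auto simp: double_star_def)
  have finite_stars: "finite B" "finite C" using cover by (metis finite_Un finite_lessThan)+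
  have "sum f {..<n} = sum f B + sum f C"
    unfolding cover[symmetric] by (rule sum.union_disjoint[OF finite_stars disjoint])
  also have "sum f B = f c + real (card B - 1) * a"
    by (rule sum_eq_off_point) (use finite_stars stars leaf in \<open>auto simp: star_centre_def\<close>)
  also have "sum f C = f d + real (card C - 1) * b"
    by (rule sum_eq_off_point) (use finite_stars stars leaf in \<open>auto simp: star_centre_def\<close>)
  finally show ?thesis .
qed

lemma rayleigh_double_star_leaves:
  assumes double: "double_star B c C d"
  shows "rayleigh {..<n} E (\<lambda>v. of_bool (v \<notin> {c, d} \<and> v < n)) =
    real (card B - 1) + real (card C - 1)"
proof -
  let ?L = "(B - {c}) \<union> (C - {d})"
  have stars: "star_centre B c" "star_centre C d" "B \<inter> C = {}" "E c d" and cover: "B \<union> C = {..<n}"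
    using double by (auto simp: double_star_def)
  have centres_in: "c \<in> B" "d \<in> C" using stars by (auto simp: star_centre_def)
  have finite_stars: "finite B" "finite C" using cover by (metis finite_Un finite_lessThan)+
  have "v \<notin> {c, d} \<and> v < n \<longleftrightarrow> v \<in> ?L" for v using cover centres_in stars(3) by auto
  moreover have "rayleigh {..<n} E (\<lambda>v. of_bool (v \<in> ?L)) = real (card ?L)"
  proof (rule rayleigh_independent_set)
    fix u v assume "u \<in> ?L" "v \<in> ?L"
    then show "\<not> E u v"
      using star_edge_iff[OF stars(1), of u v] star_edge_iff[OF stars(2), of u v]
        edge_between_adjacent_stars[OF stars, of u v] edge_between_adjacent_stars[OF stars, of v u]
        edge_sym[of u v]
      by blast
  qed (use cover in auto)
  moreover have "card ?L = card (B - {c}) + card (C - {d})"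
    using finite_stars stars(3) by (intro card_Un_disjoint) auto
  ultimately show ?thesis using centres_in by simp
qed

text \<open>Switching at \<open>c\<close> and at the leaves of \<open>C\<close> turns the double star into the complete bipartite
  graph between the two sets of leaves, with two isolated vertices. Up to this switching, this
  vector and the indicator of the leaves span the orthogonal complement of \<open>(-1, 1 / b, 1 / g)\<close>
  among the vectors that are constant on \<open>{c, d}\<close> and on the two sets of leaves.\<close>

definition double_star_vec :: "nat set \<Rightarrow> nat \<Rightarrow> nat set \<Rightarrow> nat \<Rightarrow> nat \<Rightarrow> real" where
  "double_star_vec B c C d v = (let b = real (card B - 1); g = real (card C - 1) in
    if v = c then - (b + g) / 2 else if v = d then (b + g) / 2 else if v \<in> B then g else - b)"

lemma double_star_vec_values:
  assumes "double_star B c C d"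
  shows "double_star_vec B c C d c = - (real (card B - 1) + real (card C - 1)) / 2"
    and "double_star_vec B c C d d = (real (card B - 1) + real (card C - 1)) / 2"
    and "v \<in> B - {c} \<Longrightarrow> double_star_vec B c C d v = real (card C - 1)"
    and "v \<in> C - {d} \<Longrightarrow> double_star_vec B c C d v = - real (card B - 1)"
  using assms by (auto simp: double_star_vec_def double_star_def star_centre_def Let_def)

lemma rayleigh_double_star_vec_ge:
  assumes double: "double_star B c C d"
  shows "rayleigh {..<n} E (double_star_vec B c C d) \<ge> 3"
proof -
  define w b g m where "w = double_star_vec B c C d"
    and "b = real (card B - 1)" and "g = real (card C - 1)" and "m = b + g"
  have stars: "star_centre B c" "star_centre C d" and finite_stars: "finite B" "finite C"
    using double finite_subset[of _ "{..<n}"] by (auto simp: double_star_def)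
  have ge_1: "b \<ge> 1" "g \<ge> 1" using double by (auto simp: double_star_def b_def g_def)
  have vals: "w c = - m / 2" "w d = m / 2" "\<And>v. v \<in> B - {c} \<Longrightarrow> w v = g" "\<And>v. v \<in> C - {d} \<Longrightarrow> w v = - b"
    using double_star_vec_values[OF double] by (simp_all add: w_def b_def g_def m_def)
  note sum_eq = sum_double_star[OF double, folded b_def g_def]
  have "sum w {..<n} = w c + b * g + (w d + g * (- b))" by (rule sum_eq) (simp_all only: vals)
  then have total: "sum w {..<n} = 0" by (simp add: vals(1,2))
  have "dot {..<n} w w = w c * w c + b * (g * g) + (w d * w d + g * (- b * - b))"
    unfolding dot_def by (rule sum_eq) (simp_all only: vals)
  then have norm: "dot {..<n} w w = m * (m / 2 + b * g)" by (simp add: vals(1,2) m_def field_simps)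
  have "edge_form B E w = 2 * b * w c * g"
    unfolding b_def by (rule edge_form_star[OF finite_stars(1) stars(1)]) (rule vals)
  moreover have "edge_form C E w = 2 * g * w d * (- b)"
    unfolding g_def by (rule edge_form_star[OF finite_stars(2) stars(2)]) (rule vals)
  ultimately have form: "edge_form {..<n} E w = - (m * (m / 2 + 2 * (b * g)))"
    unfolding edge_form_double_star[OF double] by (simp add: vals(1,2) m_def field_simps)
  have "rayleigh {..<n} E w = 2 * (m / 2 + 2 * (b * g)) / (m / 2 + b * g)"
    unfolding rayleigh_def total norm form using ge_1 by (simp add: m_def)
  moreover have "1 * g \<le> b * g" "b * 1 \<le> b * g" using ge_1 by (intro mult_mono; simp)+
  then have "m / 2 \<le> b * g" by (simp add: m_def)
  moreover have "m > 0" using ge_1 by (simp add: m_def)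
  ultimately show ?thesis unfolding w_def[symmetric] by (simp add: le_divide_eq)
qed

lemma energy_ge_double_star:
  assumes double: "double_star B c C d"
  shows "energy (seidel_matrix n E) \<ge> 2 * real n - 2"
proof -
  define w l where "w = double_star_vec B c C d"
    and "l v = (of_bool (v \<notin> {c, d} \<and> v < n) :: real)" for v
  define q where "q b = (if b then w else l)" for b
  have leaf: "l v = 1" if "v \<in> B - {c} \<or> v \<in> C - {d}" for v
    using that double by (auto simp: l_def double_star_def star_centre_def)
  have "dot {..<n} w l = w c * l c + real (card B - 1) * real (card C - 1) +
      (w d * l d + real (card C - 1) * (- real (card B - 1)))"
    unfolding dot_def w_def
    by (rule sum_double_star[OF double]) (simp_all add: leaf double_star_vec_values[OF double])
  then have orth: "dot {..<n} w l = 0" by (simp add: l_def)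
  have "(\<Sum>b\<in>UNIV. 2 * (rayleigh {..<n} E (q b) - 1)) \<le> energy (seidel_matrix n E)"
  proof (intro energy_ge_sum_rayleigh pairwiseI)
    show "dot {..<n} (q b) (q b') = 0" if "b \<noteq> b'" for b b'
      using that orth dot_commute[of "{..<n}" l w] by (cases b) (simp_all add: q_def)
  qed simp
  moreover have "rayleigh {..<n} E w \<ge> 3"
    unfolding w_def by (rule rayleigh_double_star_vec_ge[OF double])
  moreover have "rayleigh {..<n} E l = real (card B - 1) + real (card C - 1)"
    unfolding l_def by (rule rayleigh_double_star_leaves[OF double])
  moreover have "real n = 1 + real (card B - 1) * 1 + (1 + real (card C - 1) * 1)"
    using sum_double_star[OF double, of "\<lambda>_. 1" 1 1] by simp
  ultimately show ?thesis by (simp add: UNIV_bool q_def)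
qed

lemma energy_ge_path5:
  assumes path: "E a b" "E b c" "E c d" "E d e" and distinct: "a \<noteq> c" "b \<noteq> d" "c \<noteq> e"
  shows "energy (seidel_matrix n E) \<ge> 2 * real n - 2"
proof -
  obtain black :: "nat \<Rightarrow> bool" where black: "\<And>u v. E u v \<Longrightarrow> black u \<noteq> black v"
    using colouring by metis
  have reversed: "E b a" "E c b" "E d c" "E e d" using path edge_sym by blast+
  show ?thesis
  proof (rule energy_ge_bipartite_induced_2K2[OF black path(1) reversed(4) _ _ distinct(2)])
    show "black a = black e"
      using black[OF path(1)] black[OF path(2)] black[OF path(3)] black[OF path(4)] by blast
    show "a \<noteq> e" using no_square[of b c d a] path reversed distinct by blast
    show "\<not> E a d" using no_square[of a b c d] path reversed distinct edge_sym by blast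
    show "\<not> E e b" using no_square[of b c d e] path distinct by blast
  qed
qed

text \<open>The edge \<open>c d\<close> is found at a vertex \<open>c\<close> of maximal degree.\<close>

lemma ex_path4_unless_star:
  assumes no_star: "\<And>c. \<not> star_centre {..<n} c"
  obtains l c d x where "E c l" "E c d" "E d x" "l \<noteq> d" "x \<noteq> c"
proof -
  have "{..<n} \<noteq> {}" using tree by (auto simp: is_tree_def lessThan_empty_iff)
  then obtain c where c_less: "c < n" and Max_c: "Max (degree n E ` {..<n}) = degree n E c"
    using obtains_MAX[OF finite_lessThan] by (metis lessThan_iff)
  have max_degree: "degree n E v \<le> degree n E c" if "v < n" for v
    unfolding Max_c[symmetric] using that by (intro Max_ge) auto
  have "\<not> {..<n} \<subseteq> insert c {v. E c v}" using no_star[of c] c_less by (auto simp: star_centre_def)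
  then obtain d x where edge_cd: "E c d" and edge_dx: "E d x" "x \<noteq> c" "\<not> E c x"
    using closed_set_all[OF c_less, of "insert c {v. E c v}"] by blast
  have "card {c, x} \<le> degree n E d"
    unfolding degree_def using edge_dx(1) edge_less(2)[OF edge_dx(1)] edge_less(1)[OF edge_cd]
      edge_sym[OF edge_cd] by (intro card_mono) auto
  also have "\<dots> \<le> degree n E c" using max_degree edge_less(2)[OF edge_cd] by blast
  finally have "\<not> {v. v < n \<and> E c v} \<subseteq> {d}"
    using edge_dx(2) card_mono[of "{d}" "{v. v < n \<and> E c v}"] by (auto simp: degree_def)
  then show thesis using that edge_cd edge_dx by blast
qed

lemma tree_cases:
  obtains (star) c where "star_centre {..<n} c"
  | (double_star) B c C d where "double_star B c C d"
  | (path5) a b c d e where "E a b" "E b c" "E c d" "E d e" "a \<noteq> c" "b \<noteq> d" "c \<noteq> e"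
proof (cases "\<exists>c. star_centre {..<n} c")
  case True
  then show thesis using star by blast
next
  case False
  then obtain l c d x where edge_cl: "E c l" "l \<noteq> d" and edge_cd: "E c d"
    and edge_dx: "E d x" "x \<noteq> c"
    using ex_path4_unless_star by metis
  define B C where "B = insert c ({v. E c v} - {d})" and "C = insert d ({v. E d v} - {c})"
  show thesis
  proof (cases "{..<n} \<subseteq> B \<union> C")
    case True
    have "card {c, l} \<le> card B" by (rule card_mono) (use edge_cl in \<open>auto simp: B_def\<close>)
    moreover have "card {d, x} \<le> card C" by (rule card_mono) (use edge_dx in \<open>auto simp: C_def\<close>)
    moreover have "c \<noteq> l" "d \<noteq> x" using edge_cl edge_dx by auto
    moreover have "B \<inter> C = {}"
      using no_triangle[of c d] edge_cd edge_sym unfolding B_def C_def by blast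
    moreover have "B \<union> C \<subseteq> {..<n}" using edge_cd edge_less by (auto simp: B_def C_def)
    ultimately have "double_star B c C d"
      using True edge_cd by (auto simp: double_star_def star_centre_def B_def C_def)
    then show thesis by (rule double_star)
  next
    case False
    then obtain w y where edge_wy: "w \<in> B \<union> C" "E w y" and outside: "y \<notin> B \<union> C"
      using closed_set_all[OF edge_less(1)[OF edge_cd], of "B \<union> C"] by (auto simp: B_def)
    then consider (at_c) "E c w" "w \<noteq> d" | (at_d) "E d w" "w \<noteq> c"
      using edge_cd by (auto simp: B_def C_def)
    then show thesis
    proof cases
      case at_c
      then show thesis
        using path5[of y w c d x] edge_sym[OF edge_wy(2)] edge_sym[OF at_c(1)] outside edge_cd
          edge_dx by (auto simp: B_def)
    next
      case at_d
      then show thesis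
        using path5[of y w d c l] edge_sym[OF edge_wy(2)] edge_sym[OF at_d(1)] edge_sym[OF edge_cd]
          outside edge_cl
        by (auto simp: C_def)
    qed
  qed
qed

lemma energy_ge_2n_minus_2: "energy (seidel_matrix n E) \<ge> 2 * real n - 2"
proof (cases rule: tree_cases)
  case star
  then show ?thesis by (rule energy_ge_star)
next
  case double_star
  then show ?thesis by (rule energy_ge_double_star)
next
  case path5
  then show ?thesis by (rule energy_ge_path5)
qed

end

section \<open>Partitions into stars\<close>

definition star_gain :: "nat \<Rightarrow> real" where
  "star_gain t = 2 * sqrt (real (t - 1)) - 1"

context finite_tree
begin

definition star_partition :: "nat set set \<Rightarrow> bool" where
  "star_partition P \<longleftrightarrow> partition_on {..<n} P \<and> (\<forall>B\<in>P. \<exists>c. star_centre B c)"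

lemma star_partition_partition_on: "star_partition P \<Longrightarrow> partition_on {..<n} P"
  by (simp add: star_partition_def)

lemma star_partition_ex_centre: "star_partition P \<Longrightarrow> B \<in> P \<Longrightarrow> \<exists>c. star_centre B c"
  by (simp add: star_partition_def)

lemma star_partition_finite: "star_partition P \<Longrightarrow> finite P"
  by (rule finite_elements[OF _ star_partition_partition_on]) simp

lemma star_partition_subset: "star_partition P \<Longrightarrow> B \<in> P \<Longrightarrow> B \<subseteq> {..<n}"
  using partition_onD1[OF star_partition_partition_on] by blast

lemma star_partition_finite_block: "star_partition P \<Longrightarrow> B \<in> P \<Longrightarrow> finite B"
  by (rule finite_subset[OF star_partition_subset]) simp_all

lemma star_partition_disjoint: "star_partition P \<Longrightarrow> B \<in> P \<Longrightarrow> C \<in> P \<Longrightarrow> B \<noteq> C \<Longrightarrow> B \<inter> C = {}"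
  using partition_onD2[OF star_partition_partition_on] by (auto simp: disjoint_def)

lemma star_partition_block:
  assumes "star_partition P" "v < n"
  obtains B where "B \<in> P" "v \<in> B"
  using partition_onD1[OF star_partition_partition_on[OF assms(1)]] assms(2) by blast

end

locale partitioned_tree = finite_tree +
  fixes P :: "nat set set"
  assumes star_partition: "star_partition P" and card_ge_2: "B \<in> P \<Longrightarrow> card B \<ge> 2"
begin

lemmas partition = star_partition_partition_on[OF star_partition]
  and finite_P [simp] = star_partition_finite[OF star_partition]
  and block_subset = star_partition_subset[OF star_partition]
  and finite_block [simp] = star_partition_finite_block[OF star_partition]

definition block :: "nat \<Rightarrow> nat set" where
  "block v = (THE B. B \<in> P \<and> v \<in> B)"

lemma block_eq: "B \<in> P \<Longrightarrow> v \<in> B \<Longrightarrow> block v = B"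
  unfolding block_def using star_partition_disjoint[OF star_partition]
  by (intro the_equality) auto

lemma block_in_P: "v < n \<Longrightarrow> block v \<in> P" and in_block: "v < n \<Longrightarrow> v \<in> block v"
  using partition_onD1[OF partition] block_eq by blast+

definition centre :: "nat set \<Rightarrow> nat" where
  "centre B = (SOME c. star_centre B c)"

lemma star_centre_centre: "B \<in> P \<Longrightarrow> star_centre B (centre B)"
  unfolding centre_def by (rule someI_ex[OF star_partition_ex_centre[OF star_partition]])

lemma centre_in_block: "B \<in> P \<Longrightarrow> centre B \<in> B"
  using star_centre_centre by (simp add: star_centre_def)

definition radius :: "nat set \<Rightarrow> real" where
  "radius B = sqrt (real (card B - 1))"

lemma radius_ge_1: "B \<in> P \<Longrightarrow> radius B \<ge> 1"
  using card_ge_2[of B] by (simp add: radius_def)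

lemma radius_square: "(radius B)\<^sup>2 = real (card B - 1)"
  by (simp add: radius_def)

lemma sum_block:
  assumes "B \<in> P" "\<And>v. v \<in> B - {centre B} \<Longrightarrow> f v = b"
  shows "sum f B = f (centre B) + (radius B)\<^sup>2 * b"
  unfolding radius_square by (rule sum_eq_off_point) (use assms centre_in_block in auto)

lemma edge_form_block:
  assumes "B \<in> P" "\<And>v. v \<in> B - {centre B} \<Longrightarrow> x v = b"
  shows "edge_form B E x = 2 * (radius B)\<^sup>2 * x (centre B) * b"
  unfolding radius_square
  by (rule edge_form_star) (use assms star_centre_centre in auto)

definition weight :: "nat set \<Rightarrow> real" where
  "weight B = (1 + radius B)\<^sup>2 / 2"

lemma weight_pos: "B \<in> P \<Longrightarrow> weight B > 0"
  using radius_ge_1[of B] by (simp add: weight_def)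

lemma weight_eq:
  assumes "B \<in> P"
  shows "4 * weight B - 2 = 2 * real (card B) + 2 * star_gain (card B)"
proof -
  have "real (card B) = (radius B)\<^sup>2 + 1" using card_ge_2[OF assms] by (simp add: radius_square)
  then show ?thesis
    unfolding star_gain_def radius_def[symmetric]
    by (simp add: weight_def power2_eq_square algebra_simps)
qed

text \<open>The eigenvector of the star on \<open>B\<close> for its smallest eigenvalue, \<open>- radius B\<close>.\<close>

definition bottom_vec :: "nat set \<Rightarrow> nat \<Rightarrow> real" where
  "bottom_vec B v = (if v \<notin> B then 0 else if v = centre B then radius B else -1)"

lemma bottom_vec_centre: "B \<in> P \<Longrightarrow> bottom_vec B (centre B) = radius B"
  using centre_in_block[of B] by (simp add: bottom_vec_def)

lemma bottom_vec_leaf: "v \<in> B - {centre B} \<Longrightarrow> bottom_vec B v = -1"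
  by (simp add: bottom_vec_def)

lemma rayleigh_bottom_vec:
  assumes in_P: "B \<in> P"
  shows "rayleigh {..<n} E (bottom_vec B) = weight B"
proof -
  let ?r = "radius B"
  note vals = bottom_vec_centre[OF in_P] bottom_vec_leaf
  have "rayleigh {..<n} E (bottom_vec B) = rayleigh B E (bottom_vec B)"
    by (rule rayleigh_support) (use block_subset[OF in_P] in \<open>auto simp: bottom_vec_def\<close>)
  moreover have "sum (bottom_vec B) B = ?r - ?r\<^sup>2"
    using sum_block[OF in_P, of "bottom_vec B" "-1"] vals by simp
  moreover have "dot B (bottom_vec B) (bottom_vec B) = 2 * ?r\<^sup>2"
    unfolding dot_def using sum_block[OF in_P, of "\<lambda>v. bottom_vec B v * bottom_vec B v" 1] vals
    by (simp add: power2_eq_square)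
  moreover have "edge_form B E (bottom_vec B) = - 2 * ?r ^ 3"
    using edge_form_block[OF in_P, of "bottom_vec B" "-1"] vals
    by (simp add: power3_eq_cube power2_eq_square)
  moreover have "((?r - ?r\<^sup>2)\<^sup>2 - 2 * (- 2 * ?r ^ 3)) / (2 * ?r\<^sup>2) = weight B"
    using radius_ge_1[OF in_P] by (simp add: weight_def field_simps power2_eq_square power3_eq_cube)
  ultimately show ?thesis by (simp only: rayleigh_def)
qed

lemma dot_bottom_vec:
  assumes "B \<in> P" "C \<in> P" "B \<noteq> C"
  shows "dot {..<n} (bottom_vec B) (bottom_vec C) = 0"
proof -
  have "B \<inter> C = {}" by (rule star_partition_disjoint[OF star_partition assms])
  then show ?thesis
    unfolding dot_def by (intro sum.neutral) (auto simp: bottom_vec_def)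
qed

text \<open>The component of the all-ones vector orthogonal to all \<open>bottom_vec B\<close>; on each star it is a
  multiple of the top eigenvector.\<close>

definition top_vec :: "nat \<Rightarrow> real" where
  "top_vec v = (let r = radius (block v) in
    if v = centre (block v) then (1 + r) / 2 else (1 + 1 / r) / 2)"

lemma top_vec_centre: "B \<in> P \<Longrightarrow> top_vec (centre B) = (1 + radius B) / 2"
  using block_eq centre_in_block by (simp add: top_vec_def Let_def)

lemma top_vec_leaf: "B \<in> P \<Longrightarrow> v \<in> B - {centre B} \<Longrightarrow> top_vec v = (1 + 1 / radius B) / 2"
  using block_eq by (simp add: top_vec_def Let_def)

lemma top_vec_nonneg:
  assumes "v < n"
  shows "0 \<le> top_vec v"
proof -
  have "radius (block v) \<ge> 0" using radius_ge_1[OF block_in_P[OF assms]] by simp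
  then show ?thesis by (simp add: top_vec_def Let_def add_nonneg_nonneg)
qed

lemma top_vec_le:
  assumes "B \<in> P" "v \<in> B"
  shows "top_vec v \<le> (1 + radius B) / 2"
proof (cases "v = centre B")
  case False
  have "1 / radius B \<le> 1" using radius_ge_1[OF assms(1)] by simp
  then have "1 / radius B \<le> radius B" using radius_ge_1[OF assms(1)] by argo
  then show ?thesis using top_vec_leaf[of B v] assms False by simp
qed (use top_vec_centre assms in simp)

lemma top_vec_block:
  assumes in_P: "B \<in> P"
  shows sum_top_vec: "sum top_vec B = weight B"
    and dot_top_vec: "dot B top_vec top_vec = weight B"
    and dot_block_top_bottom: "dot B top_vec (bottom_vec B) = 0"
    and edge_form_top_vec: "edge_form B E top_vec = radius B * weight B"
proof -
  let ?r = "radius B" and ?l = "(1 + 1 / radius B) / 2"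
  note radius_ge = radius_ge_1[OF in_P]
  note vals = top_vec_centre[OF in_P] top_vec_leaf[OF in_P]
  have square: "?r\<^sup>2 * ?l = (?r\<^sup>2 + ?r) / 2" "?r\<^sup>2 * (?l * ?l) = (1 + ?r)\<^sup>2 / 4"
    using radius_ge by (simp_all add: field_simps power2_eq_square)
  have "sum top_vec B = top_vec (centre B) + ?r\<^sup>2 * ?l"
    by (rule sum_block[OF in_P]) (rule vals)
  then show "sum top_vec B = weight B"
    unfolding square vals(1) by (simp add: weight_def field_simps power2_eq_square)
  have "dot B top_vec top_vec = top_vec (centre B) * top_vec (centre B) + ?r\<^sup>2 * (?l * ?l)"
    unfolding dot_def by (rule sum_block[OF in_P]) (simp only: vals)
  then show "dot B top_vec top_vec = weight B"
    unfolding square vals(1) by (simp add: weight_def field_simps power2_eq_square)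
  have "dot B top_vec (bottom_vec B) =
      top_vec (centre B) * bottom_vec B (centre B) + ?r\<^sup>2 * (?l * - 1)"
    unfolding dot_def by (rule sum_block[OF in_P]) (simp only: vals bottom_vec_leaf)
  also have "?r\<^sup>2 * (?l * - 1) = - ((?r\<^sup>2 + ?r) / 2)" unfolding square(1)[symmetric] by simp
  finally show "dot B top_vec (bottom_vec B) = 0"
    unfolding vals(1) bottom_vec_centre[OF in_P] by (simp add: field_simps power2_eq_square)
  have "edge_form B E top_vec = 2 * ?r\<^sup>2 * top_vec (centre B) * ?l"
    by (rule edge_form_block[OF in_P]) (rule vals)
  also have "\<dots> = 2 * top_vec (centre B) * (?r\<^sup>2 * ?l)" by simp
  finally show "edge_form B E top_vec = ?r * weight B"
    unfolding square vals(1) by (simp add: weight_def field_simps power2_eq_square)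
qed

lemma dot_bottom_vec_top_vec:
  assumes "B \<in> P"
  shows "dot {..<n} (bottom_vec B) top_vec = 0" "dot {..<n} top_vec (bottom_vec B) = 0"
proof -
  have "dot {..<n} (bottom_vec B) top_vec = dot B (bottom_vec B) top_vec"
    by (rule dot_support) (use block_subset[OF assms] in \<open>auto simp: bottom_vec_def\<close>)
  then show "dot {..<n} (bottom_vec B) top_vec = 0"
    using dot_block_top_bottom[OF assms] by (simp add: dot_commute)
  then show "dot {..<n} top_vec (bottom_vec B) = 0" by (simp add: dot_commute)
qed

text \<open>The centre is the parent of any leaf whose own parent lies outside the star.\<close>

lemma outgoing_edge_unique:
  assumes orient: "\<And>u v. E u v \<Longrightarrow> p u = v \<or> p v = u"
    and outgoing: "B \<in> P" "u \<in> B" "v \<in> B" "p u \<notin> B" "p v \<notin> B"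
  shows "u = v"
proof -
  have parent: "p (centre B) = x" if "x \<in> B" "x \<noteq> centre B" "p x \<notin> B" for x
    using orient[of "centre B" x] star_centre_centre[OF outgoing(1)] centre_in_block[OF outgoing(1)]
      that
    by (auto simp: star_centre_def)
  show ?thesis using parent[of u] parent[of v] outgoing by metis
qed

abbreviation cross_edge :: "nat \<Rightarrow> nat \<Rightarrow> bool" where
  "cross_edge u v \<equiv> E u v \<and> (\<forall>B\<in>P. u \<in> B \<longrightarrow> v \<notin> B)"

lemma cross_form_top_vec_le:
  assumes radius_le: "\<And>B. B \<in> P \<Longrightarrow> radius B \<le> M"
  shows "edge_form {..<n} cross_edge top_vec \<le> (\<Sum>B\<in>P. (1 + M) * (1 + radius B) / 2)"
proof -
  obtain p where oriented: "\<And>u v. E u v \<Longrightarrow> p u = v \<or> p v = u" using orientation by metis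
  define Out where "Out = {u. u \<in> {..<n} \<and> p u \<in> {..<n} \<and> cross_edge u (p u)}"
  let ?f = "\<lambda>B. (1 + M) * (1 + radius B) / 2"
  have inj_block: "inj_on block Out"
  proof (rule inj_onI)
    fix u v assume in_Out: "u \<in> Out" "v \<in> Out" "block u = block v"
    then show "u = v"
      using block_in_P[of u] in_block[of u] in_block[of v]
      by (intro outgoing_edge_unique[of p "block u"] oriented) (auto simp: Out_def)
  qed
  have "edge_form {..<n} cross_edge top_vec \<le> (\<Sum>u\<in>Out. 2 * top_vec u * top_vec (p u))"
    unfolding Out_def
  proof (rule edge_form_le_oriented)
    show "cross_edge v u" if "cross_edge u v" for u v using that edge_sym[of u v] by blast
    show "p u = v \<or> p v = u" if "cross_edge u v" for u v using that oriented by blast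
  qed (use top_vec_nonneg in auto)
  also have "\<dots> \<le> (\<Sum>u\<in>Out. ?f (block u))"
  proof (rule sum_mono)
    fix u assume "u \<in> Out"
    then have less: "u < n" "p u < n" by (auto simp: Out_def)
    have "top_vec (p u) \<le> (1 + M) / 2"
      using top_vec_le[OF block_in_P in_block, OF less(2,2)] radius_le[OF block_in_P[OF less(2)]]
      by simp
    then have "top_vec u * top_vec (p u) \<le> (1 + radius (block u)) / 2 * ((1 + M) / 2)"
      using top_vec_le[OF block_in_P in_block, OF less(1,1)] top_vec_nonneg[OF less(1)]
        top_vec_nonneg[OF less(2)]
      by (intro mult_mono) auto
    then show "2 * top_vec u * top_vec (p u) \<le> ?f (block u)" by (simp add: algebra_simps)
  qed
  also have "\<dots> = (\<Sum>B\<in>block ` Out. ?f B)" using inj_block by (simp add: sum.reindex)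
  also have "\<dots> \<le> (\<Sum>B\<in>P. ?f B)"
  proof (rule sum_mono2)
    show "block ` Out \<subseteq> P" using block_in_P by (auto simp: Out_def)
    show "0 \<le> ?f B" if "B \<in> P - block ` Out" for B
      using that radius_ge_1[of B] radius_le[of B] by simp
  qed simp
  finally show ?thesis .
qed

lemma rayleigh_top_vec_ge:
  assumes radius_le: "\<And>B. B \<in> P \<Longrightarrow> radius B \<le> M" and n_pos: "n \<ge> 1"
  shows "rayleigh {..<n} E top_vec \<ge> sum weight P - 2 * (M + 1)"
proof -
  let ?W = "sum weight P"
  have "0 < n" using n_pos by simp
  then have W_pos: "?W > 0" using block_in_P[of 0] weight_pos by (intro sum_pos) auto
  have "edge_form {..<n} E top_vec \<le> (\<Sum>B\<in>P. radius B * weight B + (1 + M) * (1 + radius B) / 2)"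
    unfolding edge_form_partition[OF finite_lessThan partition, of E] sum.distrib
    using cross_form_top_vec_le[OF radius_le] by (simp add: edge_form_top_vec)
  also have "\<dots> \<le> (\<Sum>B\<in>P. (M + 1) * weight B)"
  proof (rule sum_mono)
    fix B assume in_P: "B \<in> P"
    have "0 \<le> radius B * (1 + radius B) * (M - radius B) / 2"
      using radius_ge_1[OF in_P] radius_le[OF in_P] by simp
    then show "radius B * weight B + (1 + M) * (1 + radius B) / 2 \<le> (M + 1) * weight B"
      by (simp add: weight_def power2_eq_square field_simps)
  qed
  also have "\<dots> = (M + 1) * ?W" by (simp add: sum_distrib_left)
  finally have form: "edge_form {..<n} E top_vec \<le> (M + 1) * ?W" .
  have "sum top_vec {..<n} = ?W" "dot {..<n} top_vec top_vec = ?W"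
    using sum.partition[OF finite_lessThan partition, of top_vec]
      sum.partition[OF finite_lessThan partition, of "\<lambda>v. top_vec v * top_vec v"]
    by (simp_all add: sum_top_vec dot_top_vec[unfolded dot_def] dot_def)
  then show ?thesis
    using form W_pos by (simp add: rayleigh_def le_divide_eq power2_eq_square algebra_simps)
qed

lemma energy_ge_sum_star_gain:
  assumes in_P: "B1 \<in> P" and largest: "\<And>B. B \<in> P \<Longrightarrow> card B \<le> card B1"
  shows "energy (seidel_matrix n E) \<ge> 2 * real n - 8 + 2 * (\<Sum>B\<in>P - {B1}. star_gain (card B))"
proof -
  define q where "q i = (case i of None \<Rightarrow> top_vec | Some B \<Rightarrow> bottom_vec B)" for i
  let ?I = "insert None (Some ` P)"
  have energy: "(\<Sum>i\<in>?I. 2 * (rayleigh {..<n} E (q i) - 1)) \<le> energy (seidel_matrix n E)"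
  proof (intro energy_ge_sum_rayleigh pairwiseI)
    fix i j assume "i \<in> ?I" "j \<in> ?I" "i \<noteq> j"
    then show "dot {..<n} (q i) (q j) = 0"
      using dot_bottom_vec dot_bottom_vec_top_vec by (cases i; cases j) (auto simp: q_def)
  qed simp
  have "radius B \<le> radius B1" if "B \<in> P" for B using largest[OF that] by (simp add: radius_def)
  moreover have "n \<ge> 1" using block_subset[OF in_P] centre_in_block[OF in_P] by auto
  ultimately have "rayleigh {..<n} E top_vec \<ge> sum weight P - 2 * (radius B1 + 1)"
    by (rule rayleigh_top_vec_ge)
  moreover have "(\<Sum>i\<in>?I. 2 * (rayleigh {..<n} E (q i) - 1)) =
      2 * (rayleigh {..<n} E top_vec - 1) + (\<Sum>B\<in>P. 2 * (weight B - 1))"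
    by (simp add: q_def sum.reindex rayleigh_bottom_vec)
  ultimately have "2 * (sum weight P - 2 * (radius B1 + 1) - 1) + (\<Sum>B\<in>P. 2 * (weight B - 1)) \<le>
      energy (seidel_matrix n E)"
    using energy by argo
  moreover have "2 * sum weight P + (\<Sum>B\<in>P. 2 * (weight B - 1)) = (\<Sum>B\<in>P. 4 * weight B - 2)"
    unfolding sum_distrib_left sum.distrib[symmetric] by (intro sum.cong) auto
  moreover have "\<dots> = (\<Sum>B\<in>P. 2 * real (card B) + 2 * star_gain (card B))"
    by (intro sum.cong refl weight_eq)
  moreover have "\<dots> = 2 * real n + 2 * (\<Sum>B\<in>P. star_gain (card B))"
    using product_partition[OF partition] by (simp add: sum.distrib sum_distrib_left)
  moreover have "(\<Sum>B\<in>P. star_gain (card B)) = 2 * radius B1 - 1 + (\<Sum>B\<in>P - {B1}. star_gain (card B))"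
    using in_P by (simp add: sum.remove star_gain_def radius_def)
  ultimately show ?thesis by argo
qed

end

section \<open>Balanced star partitions\<close>

lemma partition_on_exchange:
  assumes partition: "partition_on A P" and subset: "S \<subseteq> P" and replacement: "partition_on (\<Union>S) N"
  shows "partition_on A ((P - S) \<union> N)" and "(P - S) \<inter> N = {}"
proof -
  have disjoint: "disjnt X Y" if "X \<in> P - S" "Y \<in> N" for X Y
  proof -
    have "Y \<subseteq> \<Union>S" using that replacement by (auto simp: partition_on_def)
    moreover have "disjnt X Z" if "Z \<in> S" for Z
      using pairwiseD[OF partition_onD2[OF partition], of X Z] subset \<open>X \<in> P - S\<close> that by auto
    ultimately show ?thesis by (auto simp: disjnt_iff)
  qed
  show "partition_on A ((P - S) \<union> N)"
  proof (rule partition_onI)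
    show "\<Union>((P - S) \<union> N) = A"
      using partition_onD1[OF partition] partition_onD1[OF replacement] subset by auto
    show "{} \<notin> (P - S) \<union> N"
      using partition_onD3[OF partition] partition_onD3[OF replacement] by auto
    fix X Y assume "X \<in> (P - S) \<union> N" "Y \<in> (P - S) \<union> N" "X \<noteq> Y"
    then show "disjnt X Y"
      using pairwiseD[OF partition_onD2[OF partition], of X Y]
        pairwiseD[OF partition_onD2[OF replacement], of X Y]
        disjoint[of X Y] disjoint[of Y X] disjnt_sym[of Y X] by auto
  qed
  show "(P - S) \<inter> N = {}"
  proof (rule equals0I)
    fix X assume "X \<in> (P - S) \<inter> N"
    then show False using disjoint[of X X] partition_onD3[OF replacement] by (auto simp: disjnt_def)
  qed
qed

context finite_tree
begin

lemma star_remove_noncentre: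
  assumes "star_centre B c" "u \<in> B" "\<not> star_centre B u" "finite B"
  shows "star_centre (B - {u}) c" "card B \<ge> 3"
proof -
  have u_neq_c: "u \<noteq> c" using assms by auto
  then show "star_centre (B - {u}) c" using assms by (auto simp: star_centre_def)
  obtain x where non_neighbour: "x \<in> B" "x \<noteq> u" "\<not> E u x"
    using assms(2,3) by (auto simp: star_centre_def)
  have centre_in: "c \<in> B" using assms(1) by (simp add: star_centre_def)
  have "E u c" using assms(1,2) u_neq_c edge_sym by (auto simp: star_centre_def)
  then have "x \<noteq> c" using non_neighbour by auto
  then have "card {u, c, x} = 3" using u_neq_c non_neighbour by auto
  moreover have "{u, c, x} \<subseteq> B" using assms(2) non_neighbour centre_in by auto
  ultimately show "card B \<ge> 3" using card_mono[OF assms(4)] by metis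
qed

text \<open>Squares favour balanced partitions; the value at 1 exceeds what absorbing a singleton can
  cost.\<close>

definition block_cost :: "nat \<Rightarrow> nat" where
  "block_cost t = (if t = 1 then 2 * n + 2 else t * t)"

definition optimal_star_partition :: "nat set set \<Rightarrow> bool" where
  "optimal_star_partition P \<longleftrightarrow> star_partition P \<and>
    (\<forall>P'. star_partition P' \<longrightarrow> (\<Sum>B\<in>P. block_cost (card B)) \<le> (\<Sum>B\<in>P'. block_cost (card B)))"

lemma optimal_star_partition_imp: "optimal_star_partition P \<Longrightarrow> star_partition P"
  by (simp add: optimal_star_partition_def)

lemma ex_optimal_star_partition: "\<exists>P. optimal_star_partition P"
proof -
  have "star_partition ((\<lambda>v. {v}) ` {..<n})"
    by (auto simp: star_partition_def star_centre_def partition_on_singletons)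
  then show ?thesis
    unfolding optimal_star_partition_def
    using ex_has_least_nat[of star_partition _ "\<lambda>P. \<Sum>B\<in>P. block_cost (card B)"] by blast
qed

lemma optimal_star_partition_exchange:
  assumes optimal: "optimal_star_partition P" and subset: "S \<subseteq> P"
    and replacement: "disjoint N" "\<Union>N = \<Union>S" "\<And>X. X \<in> N \<Longrightarrow> X \<noteq> {} \<Longrightarrow> \<exists>c. star_centre X c"
  shows "(\<Sum>B\<in>S. block_cost (card B)) \<le> (\<Sum>B\<in>N. block_cost (card B))"
proof -
  let ?cost = "\<lambda>P. \<Sum>B\<in>P. block_cost (card B)"
  note star = optimal_star_partition_imp[OF optimal]
  have finite_P: "finite P" by (rule star_partition_finite[OF star])
  then have "finite (\<Union>S)"
    using subset finite_subset[OF subset] star_partition_finite_block[OF star] by blast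
  then have finite_N: "finite N" unfolding replacement(2)[symmetric] by (rule finite_UnionD)
  have "partition_on (\<Union>S) (N - {{}})"
    using replacement(1,2) pairwise_subset[of disjnt N "N - {{}}"] by (auto simp: partition_on_def)
  note exchange = partition_on_exchange[OF star_partition_partition_on[OF star] subset this]
  have "star_partition ((P - S) \<union> (N - {{}}))"
    using exchange(1) star_partition_ex_centre[OF star] replacement(3)
    by (auto simp: star_partition_def)
  then have "?cost P \<le> ?cost ((P - S) \<union> (N - {{}}))"
    using optimal by (simp add: optimal_star_partition_def)
  also have "\<dots> = ?cost (P - S) + ?cost (N - {{}})"
    using exchange(2) finite_P finite_N by (intro sum.union_disjoint) auto
  also have "?cost (N - {{}}) = ?cost N"
    using finite_N by (intro sum.mono_neutral_left) (auto simp: block_cost_def)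
  finally show ?thesis
    using sum.subset_diff[OF subset finite_P, of "\<lambda>B. block_cost (card B)"] by simp
qed

lemma optimal_star_partition_move_to_centre:
  assumes optimal: "optimal_star_partition P" and two_blocks: "B \<in> P" "C \<in> P" "B \<noteq> C"
    and moved: "l \<in> B" "B - {l} \<noteq> {} \<Longrightarrow> \<exists>c. star_centre (B - {l}) c"
    and target: "v \<in> C" "E l v" "star_centre C v"
  shows "block_cost (card B) + block_cost (card C) \<le>
    block_cost (card B - 1) + block_cost (Suc (card C))"
proof -
  note star = optimal_star_partition_imp[OF optimal]
  have disjoint: "B \<inter> C = {}" by (rule star_partition_disjoint[OF star two_blocks])
  then have "l \<notin> C" using moved by auto
  have neq: "B - {l} \<noteq> insert l C" by auto
  have "(\<Sum>X\<in>{B, C}. block_cost (card X)) \<le> (\<Sum>X\<in>{B - {l}, insert l C}. block_cost (card X))"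
  proof (rule optimal_star_partition_exchange[OF optimal])
    have "disjnt (B - {l}) (insert l C)" using disjoint by (auto simp: disjnt_def)
    then show "disjoint {B - {l}, insert l C}" by (simp add: pairwise_insert disjnt_sym)
    have "star_centre (insert l C) v"
      using target(3) edge_sym[OF target(2)] by (auto simp: star_centre_def)
    then show "\<exists>c. star_centre X c" if "X \<in> {B - {l}, insert l C}" "X \<noteq> {}" for X
      using that moved(2) by blast
  qed (use two_blocks moved in auto)
  then show ?thesis
    using two_blocks neq moved \<open>l \<notin> C\<close> star_partition_finite_block[OF star] by simp
qed

lemma optimal_star_partition_move_to_leaf:
  assumes optimal: "optimal_star_partition P" and two_blocks: "B \<in> P" "C \<in> P" "B \<noteq> C"
    and moved: "l \<in> B" "B - {l} \<noteq> {} \<Longrightarrow> \<exists>c. star_centre (B - {l}) c"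
    and target: "v \<in> C" "E l v" "\<not> star_centre C v"
  shows "card C \<ge> 3"
    and "block_cost (card B) + block_cost (card C) \<le>
      block_cost (card B - 1) + block_cost (card C - 1) + block_cost 2"
proof -
  note star = optimal_star_partition_imp[OF optimal]
  have finite_blocks: "finite B" "finite C"
    using star_partition_finite_block[OF star] two_blocks by auto
  have disjoint: "B \<inter> C = {}" by (rule star_partition_disjoint[OF star two_blocks])
  then have neq: "l \<notin> C" "v \<notin> B" "l \<noteq> v" using moved target by auto
  obtain c where "star_centre C c" using star_partition_ex_centre[OF star two_blocks(2)] by blast
  note rest = star_remove_noncentre[OF this target(1,3) finite_blocks(2)]
  have centre_in: "c \<in> C - {v}" using rest(1) by (simp add: star_centre_def)
  show "card C \<ge> 3" by (rule rest(2))
  let ?N = "{B - {l}, C - {v}, {l, v}}"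
  have "(\<Sum>X\<in>{B, C}. block_cost (card X)) \<le> (\<Sum>X\<in>?N. block_cost (card X))"
  proof (rule optimal_star_partition_exchange[OF optimal])
    have disjoint_parts: "disjnt (B - {l}) (C - {v})" "disjnt (B - {l}) {l, v}"
      "disjnt (C - {v}) {l, v}"
      using disjoint neq by (auto simp: disjnt_def)
    show "disjoint ?N"
      using disjoint_parts disjoint_parts[THEN disjnt_sym]
      by (auto simp only: pairwise_insert pairwise_empty)
    have "star_centre {l, v} l" using target by (auto simp: star_centre_def)
    then show "\<exists>c. star_centre X c" if "X \<in> ?N" "X \<noteq> {}" for X
      using that moved(2) rest(1) by blast
  qed (use two_blocks moved target in auto)
  also have "\<dots> = block_cost (card B - 1) + block_cost (card C - 1) + block_cost 2"
  proof -
    have "B - {l} \<noteq> C - {v}" "B - {l} \<noteq> {l, v}" "C - {v} \<noteq> {l, v}" using centre_in disjoint by auto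
    then show ?thesis using finite_blocks moved target neq by (simp add: numeral_2_eq_2)
  qed
  finally show "block_cost (card B) + block_cost (card C) \<le>
      block_cost (card B - 1) + block_cost (card C - 1) + block_cost 2"
    using two_blocks by simp
qed

lemma optimal_star_partition_card_ge_2:
  assumes optimal: "optimal_star_partition P" and n_ge_2: "n \<ge> 2" and B_in_P: "B \<in> P"
  shows "card B \<ge> 2"
proof (rule ccontr)
  note star = optimal_star_partition_imp[OF optimal]
  assume "\<not> card B \<ge> 2"
  moreover have "card B \<noteq> 0"
    using star_partition_finite_block[OF star B_in_P] star_partition_ex_centre[OF star B_in_P]
    by (auto simp: star_centre_def)
  ultimately have "card B = 1" by simp
  then obtain l where B_eq: "B = {l}" using card_1_singletonE by blast
  then have "l < n" using star_partition_subset[OF star B_in_P] by simp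
  then obtain v where edge_lv: "E l v" using ex_neighbour[OF n_ge_2] by blast
  then obtain C where C_in_P: "C \<in> P" "v \<in> C"
    using star_partition_block[OF star edge_less(2)[OF edge_lv]] by blast
  have "v \<noteq> l" using edge_lv by auto
  then have B_neq_C: "B \<noteq> C" using C_in_P B_eq by auto
  then have "l \<notin> C" using star_partition_disjoint[OF star B_in_P C_in_P(1)] B_eq by auto
  then have "C \<subset> {..<n}" using star_partition_subset[OF star C_in_P(1)] \<open>l < n\<close> by blast
  then have card_C: "card C < n" "card C \<noteq> 0"
    using psubset_card_mono[of "{..<n}" C] C_in_P star_partition_finite_block[OF star] by auto
  have moved: "l \<in> B" "B - {l} \<noteq> {} \<Longrightarrow> \<exists>c. star_centre (B - {l}) c" using B_eq by auto
  show False
  proof (cases "star_centre C v")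
    case True
    show False
      using optimal_star_partition_move_to_centre[OF optimal B_in_P C_in_P(1) B_neq_C moved
          C_in_P(2) edge_lv True] card_C B_eq
      by (auto simp: block_cost_def split: if_splits)
  next
    case False
    note move = optimal_star_partition_move_to_leaf[OF optimal B_in_P C_in_P(1) B_neq_C moved
        C_in_P(2) edge_lv False]
    obtain t where "card C = Suc (Suc (Suc t))"
      using move(1) by (auto simp: le_iff_add numeral_3_eq_3)
    then show False using move(2) card_C B_eq by (simp add: block_cost_def)
  qed
qed

lemma optimal_star_partition_balanced:
  assumes optimal: "optimal_star_partition P" and n_ge_2: "n \<ge> 2"
    and two_blocks: "B \<in> P" "C \<in> P" "B \<noteq> C"
    and leaf_of_B: "star_centre B c" "l \<in> B" "l \<noteq> c" "card B \<ge> 3" and edge_to_C: "v \<in> C" "E l v"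
  shows "star_centre C v" "card B \<le> Suc (card C)"
proof -
  have rest: "\<exists>c. star_centre (B - {l}) c" using leaf_of_B by (auto simp: star_centre_def)
  obtain b where card_B: "card B = Suc (Suc (Suc b))"
    using leaf_of_B(4) by (auto simp: le_iff_add numeral_3_eq_3)
  show centre: "star_centre C v"
  proof (rule ccontr)
    assume "\<not> star_centre C v"
    note move =
      optimal_star_partition_move_to_leaf[OF optimal two_blocks leaf_of_B(2) rest edge_to_C this]
    obtain t where "card C = Suc (Suc (Suc t))"
      using move(1) by (auto simp: le_iff_add numeral_3_eq_3)
    then show False using move(2) card_B by (simp add: block_cost_def)
  qed
  have "block_cost (card B) + block_cost (card C) \<le>
      block_cost (card B - 1) + block_cost (Suc (card C))"
    by (rule optimal_star_partition_move_to_centre[OF optimal two_blocks leaf_of_B(2) rest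
          edge_to_C centre])
  moreover obtain t where "card C = Suc (Suc t)"
    using optimal_star_partition_card_ge_2[OF optimal n_ge_2 two_blocks(2)]
    by (auto simp: le_iff_add numeral_2_eq_2)
  ultimately show "card B \<le> Suc (card C)" using card_B by (simp add: block_cost_def)
qed

end

section \<open>The energy of a tree\<close>

lemma star_gain_nonneg:
  assumes "t \<ge> 2"
  shows "star_gain t \<ge> 0"
proof -
  have "1 \<le> sqrt (real (t - 1))" using assms by simp
  then show ?thesis unfolding star_gain_def by argo
qed

text \<open>The ratio of \<open>star_gain t\<close> to \<open>t\<close> on \<open>2 \<le> t \<le> K\<close> is smallest at an end of the range.\<close>

lemma star_gain_ratio_ge:
  assumes range: "2 \<le> t" "t \<le> K"
  shows "real t * min (real K / 2) (star_gain K) \<le> star_gain t * real K"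
proof -
  define u U where "u = sqrt (real (t - 1))" and "U = sqrt (real (K - 1))"
  have t_eq: "real t = u\<^sup>2 + 1" and K_eq: "real K = U\<^sup>2 + 1" and u_range: "1 \<le> u" "u \<le> U"
    using range by (auto simp: u_def U_def)
  show ?thesis
  proof (cases "u \<le> 3")
    case True
    then have "(u - 1) * (3 - u) \<ge> 0" using u_range(1) by simp
    then have "real t / 2 \<le> star_gain t"
      unfolding t_eq star_gain_def u_def[symmetric] by (simp add: power2_eq_square field_simps)
    then have "real t / 2 * real K \<le> star_gain t * real K" by (rule mult_right_mono) simp
    moreover have "real t * min (real K / 2) (star_gain K) \<le> real t * (real K / 2)"
      by (intro mult_left_mono) auto
    ultimately show ?thesis by simp
  next
    case False
    have "0 \<le> (U - u) * (u * (U - 1) + U * (u - 1) - 2)"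
    proof (intro mult_nonneg_nonneg)
      have "1 * 2 \<le> u * (U - 1)" using False u_range by (intro mult_mono) auto
      moreover have "0 \<le> U * (u - 1)" using u_range by simp
      ultimately show "0 \<le> u * (U - 1) + U * (u - 1) - 2" by simp
    qed (use u_range in simp)
    then have "real t * star_gain K \<le> star_gain t * real K"
      unfolding t_eq K_eq star_gain_def u_def[symmetric] U_def[symmetric]
      by (simp add: power2_eq_square algebra_simps)
    moreover have "real t * min (real K / 2) (star_gain K) \<le> real t * star_gain K"
      by (intro mult_left_mono) auto
    ultimately show ?thesis by simp
  qed
qed

lemma sum_star_gain_ge:
  assumes finite_Q: "finite Q" and ge_2: "\<And>B. B \<in> Q \<Longrightarrow> t B \<ge> 2" and sum_pos: "sum t Q > 0"
  shows "min (real (sum t Q) / 2) (star_gain (sum t Q)) \<le> (\<Sum>B\<in>Q. star_gain (t B))"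
proof -
  define K m where "K = sum t Q" and "m = min (real K / 2) (star_gain K)"
  have "m * real K = (\<Sum>B\<in>Q. real (t B) * m)"
    by (simp add: K_def sum_distrib_left mult.commute)
  also have "\<dots> \<le> (\<Sum>B\<in>Q. star_gain (t B) * real K)"
    unfolding m_def
    by (intro sum_mono star_gain_ratio_ge ge_2)
      (auto simp: K_def intro: member_le_sum[OF _ _ finite_Q])
  also have "\<dots> = (\<Sum>B\<in>Q. star_gain (t B)) * real K" by (simp add: sum_distrib_right)
  finally show ?thesis using assms(3) by (simp add: m_def K_def[symmetric])
qed

lemma sqrt_le_min_star_gain:
  assumes K_ge_7: "K \<ge> 7" and k_bounds: "2 * k \<le> 3 * real K + 2" "k \<ge> 0"
  shows "1 + sqrt (k / 2) \<le> min (real K / 2) (star_gain K)"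
proof (rule min.boundedI)
  have "0 \<le> real K * (real K - 7)" using K_ge_7 by simp
  then have "k / 2 \<le> (real K / 2 - 1)\<^sup>2" using k_bounds by (simp add: power2_eq_square field_simps)
  then have "sqrt (k / 2) \<le> real K / 2 - 1" using K_ge_7 by (intro real_le_lsqrt) auto
  then show "1 + sqrt (k / 2) \<le> real K / 2" by simp
next
  define U where "U = sqrt (real (K - 1))"
  have U_square: "U\<^sup>2 = real K - 1" using K_ge_7 by (simp add: U_def)
  have U_ge: "U \<ge> 12 / 5"
    unfolding U_def using K_ge_7 by (intro real_le_rsqrt) (simp add: power2_eq_square)
  have "0 \<le> (U - 12 / 5) * (13 * U - 4 / 5)" using U_ge by (intro mult_nonneg_nonneg) auto
  then have "32 * U \<le> 13 * U\<^sup>2 + 11" by (simp add: power2_eq_square algebra_simps)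
  moreover have "4 * (k / 2) \<le> 3 * U\<^sup>2 + 5" using k_bounds U_square by simp
  ultimately have "k / 2 \<le> (2 * U - 2)\<^sup>2" by (simp add: power2_eq_square algebra_simps)
  then have "sqrt (k / 2) \<le> 2 * U - 2" using U_ge by (intro real_le_lsqrt) auto
  then show "1 + sqrt (k / 2) \<le> star_gain K" by (simp add: star_gain_def U_def)
qed

lemma sum_star_gain_ge_two_paths:
  assumes sizes: "finite Q" "\<And>B. B \<in> Q \<Longrightarrow> t B \<ge> 2"
    and large: "R \<subseteq> Q" "card R = 2" "\<And>B. B \<in> R \<Longrightarrow> t B \<ge> 3"
  shows "(\<Sum>B\<in>Q. star_gain (t B)) \<ge> 18 / 5"
proof -
  have "9 / 5 \<le> star_gain (t B)" if "B \<in> R" for B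
  proof -
    have "7 / 5 \<le> sqrt (real (t B - 1))"
      using large(3)[OF that] by (intro real_le_rsqrt) (simp add: power2_eq_square)
    then show ?thesis by (simp add: star_gain_def)
  qed
  then have "(\<Sum>B\<in>R. 9 / 5) \<le> (\<Sum>B\<in>R. star_gain (t B))" by (rule sum_mono)
  also have "\<dots> \<le> (\<Sum>B\<in>Q. star_gain (t B))"
    using sizes large(1) star_gain_nonneg by (intro sum_mono2) auto
  finally show ?thesis using large(2) by simp
qed

text \<open>Two stars on three vertices are the only case in which \<open>sum_star_gain_ge\<close> is too weak.\<close>

lemma sqrt_le_sum_star_gain:
  assumes sizes: "finite Q" "\<And>B. B \<in> Q \<Longrightarrow> t B \<ge> 2" and large_stars: "R \<subseteq> Q" "\<And>B. B \<in> R \<Longrightarrow> d \<le> t B"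
    and d_le: "d \<le> D + card R" and D_pos: "D \<ge> 1" and n_bounds: "n = Suc (sum t Q + d)" "D + 9 \<le> n"
  shows "1 + sqrt ((real n - real D) / 2) \<le> (\<Sum>B\<in>Q. star_gain (t B))"
proof -
  let ?K = "sum t Q" and ?G = "\<Sum>B\<in>Q. star_gain (t B)"
  have "sum t R \<le> ?K" using sizes(1) large_stars(1) by (intro sum_mono2) auto
  moreover have "card R * 2 \<le> sum t R"
    using sum_bounded_below[of R 2 t] sizes(2) large_stars(1) by auto
  moreover have "card R * d \<le> sum t R" using sum_bounded_below[of R d t] large_stars(2) by auto
  ultimately have R_le: "2 * card R \<le> ?K" "card R * d \<le> ?K" by auto
  show ?thesis
  proof (cases "?K \<ge> 7")
    case True
    have "2 * n \<le> 3 * ?K + 2 + 2 * D" using n_bounds(1) d_le R_le(1) by simp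
    then have "real (2 * n) \<le> real (3 * ?K + 2 + 2 * D)" by (simp only: of_nat_le_iff)
    then have "2 * (real n - real D) \<le> 3 * real ?K + 2" by simp
    then have "1 + sqrt ((real n - real D) / 2) \<le> min (real ?K / 2) (star_gain ?K)"
      using True n_bounds(2) by (intro sqrt_le_min_star_gain) auto
    also have "\<dots> \<le> ?G" using True by (intro sum_star_gain_ge sizes) auto
    finally show ?thesis .
  next
    case False
    have degree_bounds: "d \<ge> 3" "card R \<ge> 2" using False n_bounds d_le D_pos by auto
    have card_R: "card R = 2"
    proof (rule ccontr)
      assume "card R \<noteq> 2"
      then have "3 * 3 \<le> card R * d" using degree_bounds by (intro mult_le_mono) auto
      then show False using R_le(2) False by simp
    qed
    then have "n \<le> D + 9" using n_bounds d_le False by simp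
    then have "(real n - real D) / 2 \<le> (13 / 5)\<^sup>2" by (simp add: power2_eq_square flip: of_nat_add)
    then have "sqrt ((real n - real D) / 2) \<le> 13 / 5" by (intro real_le_lsqrt) auto
    moreover have "18 / 5 \<le> ?G"
      using large_stars(2) degree_bounds(1)
      by (intro sum_star_gain_ge_two_paths[OF sizes large_stars(1) card_R])
        (auto intro: order_trans)
    ultimately show ?thesis by simp
  qed
qed

context finite_tree
begin

lemma card_star_le:
  assumes star: "B \<subseteq> {..<n}" "star_centre B c"
  shows "card B \<le> Suc (max_leaf_nbrs n E + card {l \<in> B - {c}. \<not> is_leaf n E l})"
proof -
  let ?F = "{u. u < n \<and> E c u \<and> is_leaf n E u}" and ?L = "{l \<in> B - {c}. \<not> is_leaf n E l}"
  have finite_B: "finite B" using star(1) finite_subset by blast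
  have centre_in: "c \<in> B" using star(2) by (simp add: star_centre_def)
  have "B - {c} \<subseteq> ?F \<union> ?L" using star by (auto simp: star_centre_def)
  then have "card (B - {c}) \<le> card (?F \<union> ?L)" using finite_B by (intro card_mono) auto
  also have "\<dots> \<le> card ?F + card ?L" by (rule card_Un_le)
  also have "card ?F \<le> max_leaf_nbrs n E" using centre_in star(1) by (intro max_leaf_nbrs_ge) auto
  finally show ?thesis using centre_in finite_B by simp
qed

lemma leaves_joined_to_star_eq:
  assumes stars: "star_centre B c" "star_centre C v" "B \<inter> C = {}"
    and edge_lv: "l \<in> B - {c}" "E l v" and edge_mw: "m \<in> B - {c}" "w \<in> C" "E m w"
  shows "l = m"
proof -
  have centres_in: "c \<in> B" "v \<in> C" using stars by (auto simp: star_centre_def)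
  have edges: "E c l" "E m c"
    using edge_lv(1) edge_mw(1) stars(1) edge_sym by (auto simp: star_centre_def)
  show ?thesis
  proof (cases "v = w")
    case True
    then show ?thesis
      using no_square[of c l v m] edges edge_lv(2) edge_sym[OF edge_mw(3)] centres_in stars(3)
      by auto
  next
    case False
    then have "E v w" using stars(2) edge_mw(2) by (auto simp: star_centre_def)
    then show ?thesis
      using no_pentagon[of c l v w m] edges edge_lv edge_sym[OF edge_mw(3)] edge_mw(1,2) centres_in
        stars(3) False by auto
  qed
qed

lemma optimal_star_partition_branches:
  assumes optimal: "optimal_star_partition P" and n_ge_2: "n \<ge> 2" and B_in_P: "B \<in> P"
  obtains R where "R \<subseteq> P - {B}" "\<And>C. C \<in> R \<Longrightarrow> card B - 1 \<le> card C"
    "card B - 1 \<le> max_leaf_nbrs n E + card R"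
proof (cases "card B \<le> Suc (max_leaf_nbrs n E)")
  case True
  then show thesis using that[of "{}"] by simp
next
  case False
  then have card_B: "card B \<ge> 3" using max_leaf_nbrs_pos[OF n_ge_2] by simp
  note star = optimal_star_partition_imp[OF optimal]
  obtain c where centre: "star_centre B c" using star_partition_ex_centre[OF star B_in_P] by blast
  define L where "L = {l \<in> B - {c}. \<not> is_leaf n E l}"
  have "\<exists>C. C \<in> P - {B} \<and> card B \<le> Suc (card C) \<and> (\<exists>v\<in>C. star_centre C v \<and> E l v)"
    if in_L: "l \<in> L" for l
  proof -
    have leaf_l: "l \<in> B" "l \<noteq> c" "E l c"
      using in_L centre edge_sym by (auto simp: L_def star_centre_def)
    obtain v where edge_lv: "E l v" "v \<noteq> c" using is_leafI[OF leaf_l(3)] in_L by (auto simp: L_def)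
    obtain C where C_in_P: "C \<in> P" "v \<in> C"
      using star_partition_block[OF star edge_less(2)[OF edge_lv(1)]] by blast
    have "v \<notin> B" using star_edge_iff[OF centre leaf_l(1), of v] edge_lv leaf_l by auto
    then have "B \<noteq> C" using C_in_P by auto
    then show ?thesis
      using optimal_star_partition_balanced[OF optimal n_ge_2 B_in_P C_in_P(1) _ centre leaf_l(1,2)
          card_B C_in_P(2) edge_lv(1)] C_in_P edge_lv
      by blast
  qed
  then obtain f where chosen: "\<And>l. l \<in> L \<Longrightarrow> f l \<in> P - {B}" "\<And>l. l \<in> L \<Longrightarrow> card B \<le> Suc (card (f l))"
    "\<And>l. l \<in> L \<Longrightarrow> \<exists>v\<in>f l. star_centre (f l) v \<and> E l v"
    by metis
  have "inj_on f L"
  proof (rule inj_onI)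
    fix l m assume in_L: "l \<in> L" "m \<in> L" "f l = f m"
    obtain v w where "star_centre (f l) v" "E l v" "w \<in> f l" "E m w"
      using chosen(3)[OF in_L(1)] chosen(3)[OF in_L(2)] in_L(3) by auto
    moreover have "B \<inter> f l = {}"
      using star_partition_disjoint[OF star B_in_P] chosen(1)[OF in_L(1)] by auto
    ultimately show "l = m"
      using leaves_joined_to_star_eq[OF centre] in_L(1,2) unfolding L_def by blast
  qed
  then have "card (f ` L) = card L" by (rule card_image)
  moreover have "card B \<le> Suc (max_leaf_nbrs n E + card L)"
    unfolding L_def by (rule card_star_le[OF star_partition_subset[OF star B_in_P] centre])
  ultimately show thesis using chosen(1,2) by (intro that[of "f ` L"]) (auto simp: le_diff_conv)
qed

lemma energy_ge_far_from_star:
  assumes n_ge: "n \<ge> max_leaf_nbrs n E + 9"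
  shows "energy (seidel_matrix n E) \<ge>
    2 * real n - 6 + 2 * sqrt ((real n - real (max_leaf_nbrs n E)) / 2)"
proof -
  have n_ge_2: "n \<ge> 2" using n_ge by simp
  obtain P where optimal: "optimal_star_partition P" using ex_optimal_star_partition by blast
  interpret partitioned_tree n E P
    using optimal optimal_star_partition_card_ge_2[OF optimal n_ge_2]
    by unfold_locales (simp_all add: optimal_star_partition_def)
  have "P \<noteq> {}" using block_in_P[of 0] n_ge_2 by auto
  then obtain B1 where B1_in_P: "B1 \<in> P" and "Max (card ` P) = card B1"
    using obtains_MAX[OF finite_P] by metis
  then have largest: "card B \<le> card B1" if "B \<in> P" for B using that Max_ge[of "card ` P"] by force
  obtain R where branches: "R \<subseteq> P - {B1}" "\<And>C. C \<in> R \<Longrightarrow> card B1 - 1 \<le> card C"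
    "card B1 - 1 \<le> max_leaf_nbrs n E + card R"
    using optimal_star_partition_branches[OF optimal n_ge_2 B1_in_P] by blast
  have "n = card B1 + (\<Sum>B\<in>P - {B1}. card B)"
    using product_partition[OF partition] B1_in_P by (simp add: sum.remove)
  then have "n = Suc ((\<Sum>B\<in>P - {B1}. card B) + (card B1 - 1))" using card_ge_2[OF B1_in_P] by simp
  then have "1 + sqrt ((real n - real (max_leaf_nbrs n E)) / 2) \<le> (\<Sum>B\<in>P - {B1}. star_gain (card B))"
    using finite_P card_ge_2 branches max_leaf_nbrs_pos[OF n_ge_2] n_ge
    by (intro sqrt_le_sum_star_gain[of _ card R "card B1 - 1"]) auto
  moreover have "energy (seidel_matrix n E) \<ge>
      2 * real n - 8 + 2 * (\<Sum>B\<in>P - {B1}. star_gain (card B))"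
    by (rule energy_ge_sum_star_gain[OF B1_in_P largest])
  ultimately show ?thesis by argo
qed

end

theorem theorem1:
  fixes n :: nat and E :: "nat \<Rightarrow> nat \<Rightarrow> bool"
  assumes "is_tree n E"
  shows "energy (seidel_matrix n E)
           \<ge> 2 * real n - 6 + sqrt (2 * (real n - real (max_leaf_nbrs n E)))"
proof -
  interpret finite_tree n E using assms by unfold_locales
  define k where "k = real n - real (max_leaf_nbrs n E)"
  show ?thesis
  proof (cases "n \<ge> max_leaf_nbrs n E + 9")
    case True
    have "sqrt (2 * k) = sqrt (2\<^sup>2 * (k / 2))" by simp
    also have "\<dots> = 2 * sqrt (k / 2)" by (simp only: real_sqrt_mult real_sqrt_abs abs_numeral)
    finally show ?thesis using energy_ge_far_from_star[OF True] by (simp add: k_def)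
  next
    case False
    then have "sqrt (2 * k) \<le> 4"
      unfolding k_def by (intro real_le_lsqrt) (simp_all flip: of_nat_add)
    then show ?thesis using energy_ge_2n_minus_2 unfolding k_def by argo
  qed
qed

end
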